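(* Let $n\ge1$, let $\underline{k}$ be a right-justified composition of $n$, and let $w$ be a word of content $\underline{k}$. Then $\mathrm{tree}(w)$ is a valid slide tree (that is, $\mathrm{tree}(w)\in\mathrm{Slide}^\psi(\underline{k})$ and the edge labels given by its $\psi$ $\underline{k}$-slide labeling, read from the root outward, form the word $w$) if and only if $w$ avoids the patterns $2{-}1{-}2$ and $23{-}\overline{2}{-}1$.
   Context: **Compositions and words.** A composition of $n$ is an $n$-tuple $\underline{k}=(k_1,\dots,k_n)$ of nonnegative integers with sum $n$. It is right-justified if all zero entries occur before all nonzero entries. A word $w=w_1\cdots w_n$ has content $\underline{k}$ if each letter $i\in\{1,\dots,n\}$ occurs exactly $k_i$ times in $w$. The word $w$ avoids $2{-}1{-}2$ if there are no indices $p<q<r$ with $w_p=w_r>w_q$. It avoids $23{-}\overline{2}{-}1$ if whenever $p+1<q$ and $w_q<w_p<w_{p+1}$, there is $s$ with $p+1<s<q$ and $w_s=w_p$. **Trees.** Labels are ordered $a<b<c<1<\dots<n$. A stable tree is a finite tree whose non-leaf vertices all have degree at least 3 and whose leaves are bijectively labeled by $\{a,b,c,1,\dots,n\}$, up to label-preserving isomorphism. An internal edge joins two non-leaf vertices. **Slide labeling.** The $\psi$ $\underline{k}$-slide labeling of a stable tree $T$ is the result of the following procedure, if it never fails. For $\ell=n,n-1,\dots,1$ in this order, do the following $k_\ell$ times: let $T'$ be $T$ with all already labeled internal edges contracted; let $e$ be the first internal edge of $T'$ on the path from leaf $\ell$ to leaf $a$ (fail if none exists); let $v_\ell$ be the vertex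 of $T'$ adjacent to $\ell$ and $v$ the other endpoint of $e$; let $m_\ell$ be the smallest leaf label among branches at $v_\ell$ in $T'$ not containing $a$ or $\ell$, and $m_a$ the smallest leaf label among branches at $v$ not containing $a$ or $\ell$; if $m_\ell\ge m_a$, label $e$ with $\ell$, otherwise fail. $\mathrm{Slide}^\psi(\underline{k})$ is the set of stable trees admitting a $\psi$ $\underline{k}$-slide labeling (by a known theorem this agrees with the definition by iterated slides). Such trees are trivalent with $n$ internal edges, all labeled, and $a,b$ have a common neighbor (the root). A caterpillar tree is a trivalent tree whose internal edges form a path; its edge word is read along the path starting at the root. **The tree $\mathrm{tree}(w)$.** Given a word $w$ of content $\underline{k}$: 1. Take a path with $n$ edges (the internal edges) and attach leaf edges so that it becomes trivalent. 2. The left end is the root; label its two leaves $a$ and $b$. 3. Label the internal edges from left to right with the letters of $w$. 4. For consecutive internal edges labeled $x$ (left) and $y$ (right), the leaf between them is a descent leaf if $x>y$ and a nondescent leaf if $x\le y$. Of the two leaves at the right end, one is declared a descent leaf and the other a nondescent leaf (the rightmost one). 5. Label each descent leaf with the label of the internal edge immediately to its left. 6. List the remaining unused labels among $c,1,\dots,n$. 7. From left to right, label each nondescent leaf by the smallest remaining unused label, unless that label equals the label of the internal edge immediately to the right of that leaf, in which case use the second smallest unused label. 8. Forget the edge labels. If the resulting leaf labels are not all distinct, the tree is not a slide tree. *)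

theory Defs
  imports Main
begin

section \<open>Compositions, words, patterns\<close>

text \<open>A composition is a list of length \<open>n\<close>; its entry \<open>k\<^sub>i\<close> is \<open>ks ! (i - 1)\<close>.\<close>

definition composition :: "nat \<Rightarrow> nat list \<Rightarrow> bool" where
  "composition n ks \<longleftrightarrow> length ks = n \<and> sum_list ks = n"

definition right_justified :: "nat list \<Rightarrow> bool" where
  "right_justified ks \<longleftrightarrow>
     (\<forall>i<length ks. \<forall>j<length ks. ks ! i = 0 \<and> ks ! j \<noteq> 0 \<longrightarrow> i < j)"

definition has_content :: "nat list \<Rightarrow> nat list \<Rightarrow> bool" where
  "has_content ks w \<longleftrightarrow>
     set w \<subseteq> {1..length ks} \<and> (\<forall>i\<in>{1..length ks}. count_list w i = ks ! (i - 1))"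

definition avoids_2_1_2 :: "nat list \<Rightarrow> bool" where
  "avoids_2_1_2 w \<longleftrightarrow>
     \<not> (\<exists>p q r. p < q \<and> q < r \<and> r < length w \<and> w ! p = w ! r \<and> w ! r > w ! q)"

definition avoids_23_bar2_1 :: "nat list \<Rightarrow> bool" where
  "avoids_23_bar2_1 w \<longleftrightarrow>
     (\<forall>p q. p + 1 < q \<and> q < length w \<and> w ! q < w ! p \<and> w ! p < w ! (p + 1) \<longrightarrow>
        (\<exists>s. p + 1 < s \<and> s < q \<and> w ! s = w ! p))"

section \<open>Leaf-labeled trees\<close>

text \<open>
  Leaf labels are integers: \<open>a\<close>, \<open>b\<close>, \<open>c\<close> are encoded as \<open>-2\<close>, \<open>-1\<close>, \<open>0\<close>, so that the
  order \<open>a < b < c < 1 < \<dots> < n\<close> is the usual order on \<open>{-2..n}\<close>. Edges are two-element sets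
  of vertices. The field \<open>lab\<close> is only meaningful on leaves. Trees are handled through
  representatives: every predicate below is invariant under label-preserving isomorphism.
\<close>

abbreviation label_a :: int where "label_a \<equiv> -2"
abbreviation label_b :: int where "label_b \<equiv> -1"
abbreviation label_c :: int where "label_c \<equiv> 0"

record 'v ltree =
  verts :: "'v set"
  edges :: "'v set set"
  lab :: "'v \<Rightarrow> int"

definition degree :: "'v ltree \<Rightarrow> 'v \<Rightarrow> nat" where
  "degree T v = card {e \<in> edges T. v \<in> e}"

definition leaves :: "'v ltree \<Rightarrow> 'v set" where
  "leaves T = {v \<in> verts T. degree T v = 1}"

definition path_edges :: "'v list \<Rightarrow> 'v set list" where
  "path_edges p = map (\<lambda>(u, v). {u, v}) (zip p (tl p))"

definition is_path :: "'v ltree \<Rightarrow> 'v list \<Rightarrow> bool" where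
  "is_path T p \<longleftrightarrow>
     p \<noteq> [] \<and> distinct p \<and> set p \<subseteq> verts T \<and> set (path_edges p) \<subseteq> edges T"

definition is_tree :: "'v ltree \<Rightarrow> bool" where
  "is_tree T \<longleftrightarrow>
     finite (verts T) \<and> verts T \<noteq> {} \<and>
     (\<forall>e\<in>edges T. e \<subseteq> verts T \<and> card e = 2) \<and>
     (\<forall>u\<in>verts T. \<forall>v\<in>verts T. \<exists>p. is_path T p \<and> hd p = u \<and> last p = v) \<and>
     \<not> (\<exists>p. is_path T p \<and> length p \<ge> 3 \<and> {last p, hd p} \<in> edges T)"

definition stable_tree :: "nat \<Rightarrow> 'v ltree \<Rightarrow> bool" where
  "stable_tree n T \<longleftrightarrow>
     is_tree T \<and> (\<forall>v\<in>verts T - leaves T. degree T v \<ge> 3) \<and>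
     bij_betw (lab T) (leaves T) {label_a..int n}"

definition internal_edges :: "'v ltree \<Rightarrow> 'v set set" where
  "internal_edges T = {e \<in> edges T. e \<inter> leaves T = {}}"

section \<open>Slide labelings\<close>

text \<open>
  The vertices of \<open>contract F T\<close> are the classes of vertices of \<open>T\<close> connected through edges
  in \<open>F\<close>. When \<open>T\<close> is a tree and \<open>F\<close> consists of internal edges, no loops or parallel edges
  arise, and every leaf \<open>x\<close> becomes the leaf \<open>{x}\<close> with the same label.
\<close>

definition contract_class :: "'v set set \<Rightarrow> 'v \<Rightarrow> 'v set" where
  "contract_class F v = {u. (v, u) \<in> {(s, t). {s, t} \<in> F}\<^sup>*}"

definition contract :: "'v set set \<Rightarrow> 'v ltree \<Rightarrow> 'v set ltree" where
  "contract F T =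
     \<lparr> verts = contract_class F ` verts T,
       edges = (\<lambda>e. contract_class F ` e) ` (edges T - F),
       lab = (\<lambda>X. lab T (the_elem X)) \<rparr>"

text \<open>The branches at \<open>v\<close> are the components left after deleting \<open>v\<close>, one per neighbour.\<close>

definition branches :: "'v ltree \<Rightarrow> 'v \<Rightarrow> 'v set set" where
  "branches T v =
     {{y. (u, y) \<in> {(s, t). {s, t} \<in> edges T \<and> s \<noteq> v \<and> t \<noteq> v}\<^sup>*} | u. {u, v} \<in> edges T}"

definition branch_labels :: "'v ltree \<Rightarrow> 'v set \<Rightarrow> int set" where
  "branch_labels T B = lab T ` (B \<inter> leaves T)"

definition min_branch_label :: "'v ltree \<Rightarrow> 'v \<Rightarrow> int \<Rightarrow> int" where
  "min_branch_label T v l =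
     Min (\<Union>{branch_labels T B | B. B \<in> branches T v \<and>
             label_a \<notin> branch_labels T B \<and> l \<notin> branch_labels T B})"

text \<open>
  The partial map \<open>M\<close> records the edge labels assigned so far. On the path from the leaf
  \<open>x\<close> labeled \<open>l\<close> to the leaf labeled \<open>a\<close> in the contracted tree, the first edge is the leaf edge
  \<open>{x, vl}\<close>; the first internal edge, if there is one, is therefore \<open>{vl, v}\<close>, where \<open>v\<close> is
  not a leaf. The edge \<open>e\<close> of \<open>T\<close> is the one that becomes \<open>{vl, v}\<close>. For stable \<open>T\<close> there is at
  most one \<open>M'\<close>, and failure of the procedure means that there is none.
\<close>

definition slide_step ::
  "'v ltree \<Rightarrow> nat \<Rightarrow> ('v set \<rightharpoonup> nat) \<Rightarrow> ('v set \<rightharpoonup> nat) \<Rightarrow> bool" where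
  "slide_step T l M M' \<longleftrightarrow>
     (let T' = contract (dom M) T in
      \<exists>x vl v p e.
        is_path T' (x # vl # v # p) \<and>
        x \<in> leaves T' \<and> lab T' x = int l \<and>
        last (v # p) \<in> leaves T' \<and> lab T' (last (v # p)) = label_a \<and>
        v \<notin> leaves T' \<and>
        min_branch_label T' vl (int l) \<ge> min_branch_label T' v (int l) \<and>
        e \<in> edges T - dom M \<and> contract_class (dom M) ` e = {vl, v} \<and>
        M' = M(e \<mapsto> l))"

primrec slide_steps ::
  "'v ltree \<Rightarrow> nat list \<Rightarrow> ('v set \<rightharpoonup> nat) \<Rightarrow> ('v set \<rightharpoonup> nat) \<Rightarrow> bool" where
  "slide_steps T [] M M' \<longleftrightarrow> M' = M"
| "slide_steps T (l # ls) M M' \<longleftrightarrow>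
     (\<exists>M1. slide_step T l M M1 \<and> slide_steps T ls M1 M')"

definition slide_labeling :: "nat list \<Rightarrow> 'v ltree \<Rightarrow> ('v set \<rightharpoonup> nat) \<Rightarrow> bool" where
  "slide_labeling ks T M \<longleftrightarrow>
     slide_steps T
       (concat (map (\<lambda>l. replicate (ks ! (l - 1)) l) (rev [1..<length ks + 1])))
       Map.empty M"

definition Slide_psi :: "nat list \<Rightarrow> 'v ltree set" where
  "Slide_psi ks = {T. stable_tree (length ks) T \<and> (\<exists>M. slide_labeling ks T M)}"

section \<open>Caterpillar trees\<close>

text \<open>\<open>vs\<close> lists the non-leaf vertices from the root outward.\<close>

definition caterpillar_spine :: "'v ltree \<Rightarrow> 'v list \<Rightarrow> bool" where
  "caterpillar_spine T vs \<longleftrightarrow>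
     is_tree T \<and> (\<forall>v\<in>verts T - leaves T. degree T v = 3) \<and>
     is_path T vs \<and> set (path_edges vs) = internal_edges T \<and>
     (\<exists>x\<in>leaves T. lab T x = label_a \<and> {x, hd vs} \<in> edges T) \<and>
     (\<exists>x\<in>leaves T. lab T x = label_b \<and> {x, hd vs} \<in> edges T)"

definition has_edge_word :: "'v ltree \<Rightarrow> ('v set \<rightharpoonup> nat) \<Rightarrow> nat list \<Rightarrow> bool" where
  "has_edge_word T M w \<longleftrightarrow>
     (\<exists>vs. caterpillar_spine T vs \<and> map M (path_edges vs) = map Some w)"

section \<open>The tree of a word\<close>

text \<open>
  With \<open>n = length w\<close>, the spine is \<open>Spine 0, \<dots>, Spine n\<close>, and the \<open>i\<close>-th internal edge (counting
  from 1) joins \<open>Spine (i - 1)\<close> to \<open>Spine i\<close> and carries \<open>w ! (i - 1)\<close>. For \<open>1 \<le> i \<le> n\<close>, \<open>Leaf i\<close>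
  hangs off \<open>Spine i\<close>; \<open>Leaf n\<close> is the descent leaf at the right end, and \<open>Leaf (n + 1)\<close>, also
  attached to \<open>Spine n\<close>, is the rightmost, nondescent leaf.
\<close>

datatype cat_vertex = Spine nat | Leaf_a | Leaf_b | Leaf nat

text \<open>The labels of the descent leaves, including the one at the right end.\<close>

fun descent_labels :: "nat list \<Rightarrow> int set" where
  "descent_labels [] = {}"
| "descent_labels [x] = {int x}"
| "descent_labels (x # y # w) =
     (if x > y then {int x} else {}) \<union> descent_labels (y # w)"

text \<open>
  \<open>leaf_labels U w\<close> lists the labels of \<open>Leaf 1, \<dots>, Leaf (n + 1)\<close>, where \<open>U\<close> is the set of
  labels still unused. There are always enough unused labels, so \<open>Min\<close> is only applied to
  nonempty sets when starting from the set in \<open>word_labels\<close>.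
\<close>

fun leaf_labels :: "int set \<Rightarrow> nat list \<Rightarrow> int list" where
  "leaf_labels U [] = [Min U]"
| "leaf_labels U [x] = [int x, Min U]"
| "leaf_labels U (x # y # w) =
     (if x > y then int x # leaf_labels U (y # w)
      else let m = (if Min U = int y then Min (U - {Min U}) else Min U)
           in m # leaf_labels (U - {m}) (y # w))"

definition word_labels :: "nat list \<Rightarrow> int list" where
  "word_labels w = leaf_labels ({label_c..int (length w)} - descent_labels w) w"

primrec cat_label :: "nat list \<Rightarrow> cat_vertex \<Rightarrow> int" where
  "cat_label w (Spine i) = undefined"
| "cat_label w Leaf_a = label_a"
| "cat_label w Leaf_b = label_b"
| "cat_label w (Leaf i) = word_labels w ! (i - 1)"

definition tree_of_word :: "nat list \<Rightarrow> cat_vertex ltree" where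
  "tree_of_word w =
     (let n = length w in
      \<lparr> verts = Spine ` {0..n} \<union> {Leaf_a, Leaf_b} \<union> Leaf ` {1..n + 1},
        edges = {{Spine i, Spine (i + 1)} | i. i < n}
              \<union> {{Spine 0, Leaf_a}, {Spine 0, Leaf_b}}
              \<union> {{Spine i, Leaf i} | i. 1 \<le> i \<and> i \<le> n}
              \<union> {{Spine n, Leaf (n + 1)}},
        lab = cat_label w \<rparr>)"

end

theory Submission
  imports Defs
begin

text \<open>
  Edges and leaves along the spine are counted from 0: edge \<open>i\<close> joins \<open>Spine i\<close> to
  \<open>Spine (i + 1)\<close> and carries \<open>w ! i\<close>, and leaf \<open>j\<close> is the vertex \<open>Leaf (j + 1)\<close> with label
  \<open>word_labels w ! j\<close>. Leaf \<open>j\<close> lies to the right of edge \<open>i\<close> iff \<open>i \<le> j\<close>.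

  \<^emph>\<open>What the slide labeling says about a caterpillar.\<close> Contracting internal edges of a caterpillar
  merges intervals of the spine. One step with the letter \<open>l\<close> therefore labels the last unlabeled
  edge \<open>i\<close> to the left of the leaf labeled \<open>l\<close>, provided that edge \<open>i\<close> is the first unlabeled
  edge or that, for the previous unlabeled edge \<open>h\<close>, some leaf among \<open>h, \<dots>, i - 1\<close> has a label
  below those of all leaves from \<open>i\<close> on, \<open>l\<close> excluded (\<open>slide_step_left\<close>, \<open>slide_stepI\<close>).
  Since letters are processed in decreasing order, obtaining the edge word \<open>w\<close> forces, for every \<open>i\<close>,
  the leaf labeled \<open>w ! i\<close> to lie to the right of edge \<open>i\<close> with no smaller letter in between
  (\<open>well_placed\<close>). Conversely, this together with the inequalities between leaf labels is
  sufficient (\<open>slide_steps_exist\<close>).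

  \<^emph>\<open>Counting.\<close> Let \<open>U\<close> be the set of labels that are not descent letters; if no
  letter has two descents, as when \<open>w\<close> avoids 2-1-2, the nondescent leaves carry exactly the labels
  in \<open>U\<close>. Fix a leaf \<open>j < n\<close> and consider the letters that occur after \<open>j\<close> or occur at
  a descent up to \<open>j\<close>. They include all descent letters, and there are at most \<open>n\<close> minus the
  number of nondescent leaves up to \<open>j\<close> of them. If they also include a set \<open>X\<close> of letters
  \<open>\<ge> x\<close>, then the number of nondescent leaves up to \<open>j\<close> plus the size of \<open>X\<close> is at most
  \<open>n - x\<close> plus the number of elements of \<open>U\<close> below \<open>x\<close> (\<open>nondescent_count\<close>). Right-justification
  enters here: every number between a letter and \<open>n\<close> is itself a letter.

  \<^emph>\<open>Avoidance suffices.\<close> If \<open>w\<close> avoids both patterns, a letter followed later by a smaller one is a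
  descent letter, so for \<open>q > j\<close> one may take \<open>X = {w ! q..n}\<close>. The resulting bound says that every
  nondescent leaf has a label smaller than all letters to its right (\<open>nondescent_label_less\<close>). Both
  \<open>well_placed\<close> and the label inequalities follow.

  \<^emph>\<open>Avoidance is necessary.\<close> If the labels are distinct and well placed, a pattern 2-1-2 is
  impossible at once. An occurrence of the other pattern yields a letter \<open>l\<close> in \<open>U\<close>
  that is followed by a smaller letter. Take \<open>l\<close> maximal and let \<open>t\<close> be its leaf. All elements of \<open>U\<close> below \<open>l\<close> are used
  before \<open>t\<close>, while by maximality \<open>X = {l + 1..n}\<close> is admissible at \<open>t\<close>; the bound is violated
  by one (\<open>well_placed_avoids_23_bar2_1\<close>).
\<close>

section \<open>Leaf labels of the tree of a word\<close>

text \<open>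
  The nondescent leaves. Leaf \<open>length w\<close> is the rightmost one, which is always a nondescent leaf.
\<close>

definition nondescents :: "nat list \<Rightarrow> nat set" where
  "nondescents w = {j. j = length w \<or> Suc j < length w \<and> w ! j \<le> w ! Suc j}"

text \<open>
  The descent leaves, including the one at the right end, which belongs to the last letter.
\<close>

definition descents :: "nat list \<Rightarrow> nat set" where
  "descents w = {j. j < length w \<and> (Suc j < length w \<longrightarrow> w ! Suc j < w ! j)}"

lemma finite_nondescents [simp]: "finite (nondescents w)"
  by (rule finite_subset[of _ "{..length w}"]) (auto simp: nondescents_def)

lemma finite_descents [simp]: "finite (descents w)"
  by (rule finite_subset[of _ "{..length w}"]) (auto simp: descents_def)

lemma descents_disjoint: "descents w \<inter> nondescents w = {}"
  by (auto simp: descents_def nondescents_def)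

lemma descents_Un: "w \<noteq> [] \<Longrightarrow> descents w \<union> nondescents w = {..length w}"
  by (auto simp: descents_def nondescents_def)

lemma nondescents_single: "nondescents [x] = {1}"
  by (auto simp: nondescents_def)

lemma nondescents_Cons2:
  "nondescents (x # y # w) = (if x \<le> y then {0} else {}) \<union> Suc ` nondescents (y # w)"
  by (rule set_eqI, rename_tac j, case_tac j) (auto simp: nondescents_def image_iff)

lemma descents_Cons2:
  "descents (x # y # w) = (if y < x then {0} else {}) \<union> Suc ` descents (y # w)"
  by (rule set_eqI, rename_tac j, case_tac j) (auto simp: descents_def image_iff)

lemma descent_labels_eq: "descent_labels w = (\<lambda>j. int (w ! j)) ` descents w"
proof (induction w rule: descent_labels.induct)
  case (3 x y w)
  then show ?case by (auto simp: descents_Cons2 image_image image_Un)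
qed (auto simp: descents_def)

lemma leaf_labels_descents:
  "j \<in> descents w \<Longrightarrow> leaf_labels U w ! j = int (w ! j)"
proof (induction U w arbitrary: j rule: leaf_labels.induct)
  case (3 U x y w)
  show ?case
  proof (cases j)
    case 0
    then show ?thesis using 3(3) by (auto simp: descents_def)
  next
    case (Suc i)
    then have "i \<in> descents (y # w)" using 3(3) by (auto simp: descents_Cons2 split: if_splits)
    then show ?thesis using 3(1) 3(2)[OF _ refl] Suc by (auto simp: Let_def)
  qed
qed (auto simp: descents_def)

text \<open>
  The only way in which the labels of nondescent leaves fail to increase from left to right: a label
  is skipped at leaf \<open>j\<close> because the next edge carries it, and it is used later.
\<close>

lemma leaf_labels_nondescents:
  assumes "w \<noteq> []" "finite U" "card U = card (nondescents w)"
  shows "(!) (leaf_labels U w) ` nondescents w = U \<and>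
    (\<forall>j\<in>nondescents w. \<forall>k\<in>nondescents w. j < k \<longrightarrow>
       leaf_labels U w ! k < leaf_labels U w ! j \<longrightarrow> leaf_labels U w ! k = int (w ! Suc j))"
  using assms
proof (induction U w rule: leaf_labels.induct)
  case (2 U x)
  then obtain u where "U = {u}" by (auto simp: nondescents_single card_Suc_eq)
  then show ?case by (simp add: nondescents_single)
next
  case (3 U x y w)
  have c: "card (Suc ` nondescents (y # w)) = card (nondescents (y # w))" 
    by (simp add: card_image)
  show ?case
  proof (cases "y < x")
    case True
    then have "card U = card (nondescents (y # w))" 
      using 3(5) c by (simp add: nondescents_Cons2)
    note IH = 3(1)[OF True _ 3(4) this]
    then show ?thesis using True 
      by (auto simp: nondescents_Cons2 image_image)
  next
    case False
    define m where "m = (if Min U = int y then Min (U - {Min U}) else Min U)"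
    have cU: "card U = Suc (card (nondescents (y # w)))" 
      using 3(5) c False by (simp add: nondescents_Cons2)
    have "nondescents (y # w) \<noteq> {}" by (auto simp: nondescents_def)
    then have c2: "card U \<ge> 2" using cU by (simp add: Suc_le_eq card_gt_0_iff)
    have "U \<noteq> {}" using c2 by auto
    have MU: "Min U \<in> U" using \<open>U \<noteq> {}\<close> 3(4) by simp
    have ne: "U - {Min U} \<noteq> {}"
    proof
      assume "U - {Min U} = {}"
      then have "U \<subseteq> {Min U}" by auto
      then have "card U \<le> 1" using card_mono[of "{Min U}" U] by simp
      then show False using c2 by simp
    qed
    have M2: "Min (U - {Min U}) \<in> U - {Min U}" using ne 3(4) by (intro Min_in) auto
    have mU: "m \<in> U" using MU M2 by (auto simp: m_def)
    have "card (U - {m}) = card (nondescents (y # w))" using cU mU 3(4) by simp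
    then have IH: "(!) (leaf_labels (U - {m}) (y # w)) ` nondescents (y # w) = U - {m}"
      "\<forall>j\<in>nondescents (y # w). \<forall>k\<in>nondescents (y # w). j < k \<longrightarrow>
       leaf_labels (U - {m}) (y # w) ! k < leaf_labels (U - {m}) (y # w) ! j \<longrightarrow> 
       leaf_labels (U - {m}) (y # w) ! k = int ((y # w) ! Suc j)"
      using 3(2)[OF False m_def] 3(4) by auto
    have eq: "leaf_labels U (x # y # w) = m # leaf_labels (U - {m}) (y # w)" 
      using False by (simp add: m_def Let_def)
    \<comment> \<open>the minimum is passed over only if it is \<open>y\<close>; all other remaining labels exceed \<open>m\<close>\<close>
    have small: "u = int y" if "u \<in> U - {m}" "u < m" for u
    proof (cases "Min U = int y")
      case True
      have "u = Min U"
      proof (rule ccontr)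
        assume "u \<noteq> Min U"
        then have "m \<le> u" using that 3(4) True by (auto simp: m_def)
        then show False using that by simp
      qed
      then show ?thesis using True by simp
    next
      case False
      then have "m \<le> u" using that 3(4) by (auto simp: m_def)
      then show ?thesis using that by simp
    qed
    have nd: "nondescents (x # y # w) = insert 0 (Suc ` nondescents (y # w))" 
      using False by (simp add: nondescents_Cons2)
    show ?thesis unfolding eq nd
    proof (intro conjI ballI impI)
      show "(!) (m # leaf_labels (U - {m}) (y # w)) ` insert 0 (Suc ` nondescents (y # w)) = U"
        using IH(1) mU by (auto simp: image_image)
    next
      fix j k
      assume j: "j \<in> insert 0 (Suc ` nondescents (y # w))"
        and k: "k \<in> insert 0 (Suc ` nondescents (y # w))" and "j < k"
        and less: "(m # leaf_labels (U - {m}) (y # w)) ! k < (m # leaf_labels (U - {m}) (y # w)) ! j"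
      obtain k' where k': "k = Suc k'" "k' \<in> nondescents (y # w)" using k \<open>j < k\<close> by auto
      show "(m # leaf_labels (U - {m}) (y # w)) ! k = int ((x # y # w) ! Suc j)"
      proof (cases j)
        case 0
        then show ?thesis using k' less IH(1) small by auto
      next
        case (Suc j')
        then show ?thesis using k' less IH(2) j \<open>j < k\<close> by auto
      qed
    qed
  qed
qed auto

locale nonempty_word =
  fixes w :: "nat list"
  assumes nonempty: "w \<noteq> []"
begin

abbreviation "n \<equiv> length w"
abbreviation "leaf_label j \<equiv> word_labels w ! j"

lemma n_pos: "0 < n"
  using nonempty by simp

end

section \<open>Counting nondescent leaves\<close>

lemma inj_on_descents:
  assumes "avoids_2_1_2 w"
  shows "inj_on ((!) w) (descents w)"
proof (rule linorder_inj_onI)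
  fix i j assume "i < j" "i \<in> descents w" "j \<in> descents w"
  show "w ! i \<noteq> w ! j"
  proof
    assume eq: "w ! i = w ! j"
    have "w ! Suc i < w ! i" "j < length w" 
      using \<open>i < j\<close> \<open>i \<in> descents w\<close> \<open>j \<in> descents w\<close> by (auto simp: descents_def)
    moreover from this have "Suc i < j" using eq \<open>i < j\<close> by (cases "Suc i = j") auto
    ultimately show False using assms eq unfolding avoids_2_1_2_def 
      by (metis lessI)
  qed
qed auto

text \<open>
  The words whose content is a right-justified composition: the letters form a final segment of
  \<open>{1..n}\<close>, where \<open>n\<close> is the length.
\<close>

locale full_word = nonempty_word +
  assumes letters: "set w \<subseteq> {1..length w}"
    and upward_closed: "x \<in> set w \<Longrightarrow> x \<le> y \<Longrightarrow> y \<le> length w \<Longrightarrow> y \<in> set w"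
begin

text \<open>
  The labels available for nondescent leaves.
\<close>

definition unused :: "int set" where
  "unused = {0..int n} - (\<lambda>j. int (w ! j)) ` descents w"

lemma word_labels_eq: "word_labels w = leaf_labels unused w"
  by (simp add: word_labels_def unused_def descent_labels_eq)

lemma finite_unused [simp]: "finite unused"
  by (simp add: unused_def)

lemma letter_bounds: "i < n \<Longrightarrow> 1 \<le> w ! i \<and> w ! i \<le> n"
  using subsetD[OF letters nth_mem[of i w]] by auto

lemma leaf_label_descent: "j \<in> descents w \<Longrightarrow> leaf_label j = int (w ! j)"
  by (simp add: word_labels_eq leaf_labels_descents)

lemma card_descents_nondescents: "card (descents w) + card (nondescents w) = Suc n"
proof -
  have "card (descents w) + card (nondescents w) = card (descents w \<union> nondescents w)"
    using descents_disjoint by (intro card_Un_disjoint[symmetric]) auto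
  then show ?thesis using descents_Un[OF nonempty] by simp
qed

text \<open>
  The letters that occur to the right of leaf \<open>j\<close> or at a descent not to the right of it.
\<close>

definition seen_or_closed :: "nat \<Rightarrow> nat set" where
  "seen_or_closed j = (!) w ` ({j<..<n} \<union> descents w \<inter> {..j})"

lemma card_seen_or_closed:
  assumes "j < n"
  shows "card (seen_or_closed j) + card (nondescents w \<inter> {..j}) \<le> n"
proof -
  have "card (seen_or_closed j) \<le> card ({j<..<n} \<union> descents w \<inter> {..j})"
    unfolding seen_or_closed_def by (rule card_image_le) auto
  also have "\<dots> \<le> card {j<..<n} + card (descents w \<inter> {..j})" by (rule card_Un_le)
  finally have 1: "card (seen_or_closed j) \<le> n - Suc j + card (descents w \<inter> {..j})" by simp
  have "card (descents w \<inter> {..j}) + card (nondescents w \<inter> {..j}) =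
      card (descents w \<inter> {..j} \<union> nondescents w \<inter> {..j})"
    using descents_disjoint by (intro card_Un_disjoint[symmetric]) auto
  also have "descents w \<inter> {..j} \<union> nondescents w \<inter> {..j} = {..j}"
    using descents_Un[OF nonempty] assms by (subst Int_Un_distrib2[symmetric]) (simp add: Int_absorb1)
  finally show ?thesis using 1 assms by simp
qed

text \<open>
  The counting argument behind both directions: the descent letters below \<open>x\<close> and the set \<open>X\<close>
  are disjoint parts of \<open>seen_or_closed j\<close>.
\<close>

lemma nondescent_count:
  assumes j: "j < n" and x: "x \<le> n" and X: "X \<subseteq> {x..n}" "X \<subseteq> seen_or_closed j"
  shows "card (nondescents w \<inter> {..j}) + card X + x \<le> n + card {u \<in> unused. u < int x}"
proof -
  define Dx where "Dx = {d \<in> (!) w ` descents w. d < x}"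
  have D: "(!) w ` descents w \<subseteq> seen_or_closed j"
    by (auto simp: seen_or_closed_def descents_def)
  have fX: "finite X" using X(1) finite_subset by blast
  have fin: "finite Dx" by (simp add: Dx_def)
  have "card Dx + card X = card (Dx \<union> X)"
    using X fX by (intro card_Un_disjoint[symmetric]) (auto simp: Dx_def)
  also have "\<dots> \<le> card (seen_or_closed j)"
    using D X by (intro card_mono) (auto simp: seen_or_closed_def Dx_def)
  finally have 1: "card Dx + card X + card (nondescents w \<inter> {..j}) \<le> n"
    using card_seen_or_closed[OF j] by simp
  have "{0..<int x} = {u \<in> unused. u < int x} \<union> int ` Dx"
  proof (rule set_eqI)
    fix u show "u \<in> {0..<int x} \<longleftrightarrow> u \<in> {u \<in> unused. u < int x} \<union> int ` Dx"
      using x by (cases "u \<in> (\<lambda>j. int (w ! j)) ` descents w") 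
        (auto simp: unused_def Dx_def)
  qed
  then have "card {0..<int x} \<le> card {u \<in> unused. u < int x} + card (int ` Dx)"
    by (simp add: card_Un_le)
  moreover have "card (int ` Dx) = card Dx" by (simp add: card_image)
  ultimately show ?thesis using 1 by simp
qed

end

locale full_word_212 = full_word +
  assumes avoids_212: "avoids_2_1_2 w"
begin

text \<open>
  After a descent its letter cannot recur: the smaller letter next to it would complete a pattern 2-1-2.
\<close>

lemma descent_last: 
  assumes "i \<in> descents w" "i < j" "j < n"
  shows "w ! j \<noteq> w ! i"
proof
  assume eq: "w ! j = w ! i"
  have "w ! Suc i < w ! i" using assms by (auto simp: descents_def)
  moreover from this have "Suc i < j" using eq assms by (cases "Suc i = j") auto
  ultimately show False using avoids_212 eq assms(3) unfolding avoids_2_1_2_def 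
    by (metis lessI)
qed

lemma card_unused: "card unused = card (nondescents w)"
proof -
  have "card ((\<lambda>j. int (w ! j)) ` descents w) = card (descents w)"
    using inj_on_descents[OF avoids_212] by (intro card_image) (auto simp: inj_on_def)
  moreover have "(\<lambda>j. int (w ! j)) ` descents w \<subseteq> {0..int n}"
    using letter_bounds by (auto simp: descents_def)
  ultimately have "card unused = Suc n - card (descents w)"
    by (simp add: unused_def card_Diff_subset)
  then show ?thesis using card_descents_nondescents by simp
qed

lemma nondescent_labels: "(!) (word_labels w) ` nondescents w = unused"
  using leaf_labels_nondescents[OF nonempty finite_unused card_unused] by (simp add: word_labels_eq)

lemma inj_on_nondescents: "inj_on ((!) (word_labels w)) (nondescents w)"
  using nondescent_labels card_unused by (intro eq_card_imp_inj_on) auto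

lemma later_smaller_label:
  assumes "j \<in> nondescents w" "k \<in> nondescents w" "j < k" "leaf_label k < leaf_label j"
  shows "leaf_label k = int (w ! Suc j)"
  using leaf_labels_nondescents[OF nonempty finite_unused card_unused] assms 
  by (simp add: word_labels_eq)

lemma bij_betw_leaf_label: "bij_betw ((!) (word_labels w)) {..n} {0..int n}"
proof -
  have img: "(!) (word_labels w) ` descents w = (\<lambda>j. int (w ! j)) ` descents w"
    by (intro image_cong refl leaf_label_descent)
  have sub: "(\<lambda>j. int (w ! j)) ` descents w \<subseteq> {0..int n}"
    using letter_bounds by (auto simp: descents_def)
  have "inj_on (\<lambda>j. int (w ! j)) (descents w)" 
    using inj_on_descents[OF avoids_212] by (auto simp: inj_on_def)
  then have "inj_on ((!) (word_labels w)) (descents w)"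
    using leaf_label_descent by (auto simp: inj_on_def)
  then have "bij_betw ((!) (word_labels w)) (descents w) ((\<lambda>j. int (w ! j)) ` descents w)"
    using img by (simp add: bij_betw_def)
  moreover have "bij_betw ((!) (word_labels w)) (nondescents w) unused"
    using nondescent_labels inj_on_nondescents by (simp add: bij_betw_def)
  ultimately have "bij_betw ((!) (word_labels w)) (descents w \<union> nondescents w) 
      ((\<lambda>j. int (w ! j)) ` descents w \<union> unused)"
    by (rule bij_betw_combine) (auto simp: unused_def)
  moreover have "(\<lambda>j. int (w ! j)) ` descents w \<union> unused = {0..int n}"
    using sub by (auto simp: unused_def)
  ultimately show ?thesis using descents_Un[OF nonempty] by simp
qed

end

text \<open>
  The leaf labeled by the letter of an edge lies to the right of that edge, and no smaller letter
  separates the two.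
\<close>

definition well_placed :: "nat list \<Rightarrow> bool" where
  "well_placed w \<longleftrightarrow>
     (\<forall>i<length w. \<exists>j\<le>length w. word_labels w ! j = int (w ! i) \<and> i \<le> j \<and>
        (\<forall>k<length w. i \<le> k \<and> k \<le> j \<longrightarrow> w ! i \<le> w ! k))"

locale avoiding_word = full_word_212 +
  assumes avoids_23_bar2_1: "avoids_23_bar2_1 w"
begin

text \<open>
  This is where avoidance of 23-bar2-1 is used: only descent letters are followed by smaller letters.
\<close>

lemma descent_letter_if_smaller_later:
  assumes "p < q" "q < n" "w ! q < w ! p"
  shows "\<exists>i\<in>descents w. w ! i = w ! p"
proof (rule ccontr)
  assume nd: "\<not> ?thesis"
  \<comment> \<open>if no descent carries this letter, its last occurrence before \<open>q\<close> starts a forbidden pattern\<close>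
  define P where "P = {i. i < q \<and> w ! i = w ! p}"
  define m where "m = Max P"
  have P: "finite P" "p \<in> P" using assms by (auto simp: P_def)
  have m: "m < q" "w ! m = w ! p" 
  proof -
    have "m \<in> P" unfolding m_def using P by (intro Max_in) auto
    then show "m < q" "w ! m = w ! p" by (auto simp: P_def)
  qed
  have above: "i \<le> m" if "i < q" "w ! i = w ! p" for i
    using that P unfolding m_def by (intro Max_ge) (auto simp: P_def)
  have "m \<notin> descents w" using nd m by auto
  then have "w ! m \<le> w ! Suc m" "Suc m < n" using m assms by (auto simp: descents_def)
  moreover have "Suc m < q" using m assms(3) calculation by (cases "Suc m = q") auto
  moreover have "w ! Suc m \<noteq> w ! m" using above[of "Suc m"] m calculation by auto
  ultimately obtain s where "Suc m < s" "s < q" "w ! s = w ! m"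
    using avoids_23_bar2_1 assms m unfolding avoids_23_bar2_1_def
    by (metis Suc_eq_plus1 le_neq_implies_less)
  then show False using above[of s] m by auto
qed

text \<open>
  The counting bound with \<open>X = {w ! q..n}\<close> leaves two unused labels below \<open>w ! q\<close> for the leaves after \<open>j\<close> if
  leaf \<open>j\<close> itself does not receive such a label, but at most one label is skipped at \<open>j\<close>.
\<close>

lemma nondescent_label_less:
  assumes j: "j \<in> nondescents w" and "j < q" "q < n"
  shows "leaf_label j < int (w ! q)"
proof (rule ccontr)
  assume ge: "\<not> ?thesis"
  define x where "x = w ! q"
  have x: "x \<le> n" "x \<in> set w" using letter_bounds[of q] assms by (auto simp: x_def)
  have "{x..n} \<subseteq> seen_or_closed j"
  proof
    fix e assume e: "e \<in> {x..n}"
    then obtain i where i: "i < n" "w ! i = e" 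
      using upward_closed[OF x(2)] by (auto simp: in_set_conv_nth)
    show "e \<in> seen_or_closed j"
    proof (cases "j < i \<or> e = x")
      case True
      then show ?thesis using i assms by (auto simp: seen_or_closed_def x_def)
    next
      case False
      then have "w ! q < w ! i" "i < q" using e i assms by (auto simp: x_def)
      then obtain d where "d \<in> descents w" "w ! d = e"
        using descent_letter_if_smaller_later[of i q] i assms by auto
      then show ?thesis by (cases "d \<le> j") (auto simp: seen_or_closed_def descents_def)
    qed
  qed
  then have count: "card (nondescents w \<inter> {..j}) + 1 \<le> card {u \<in> unused. u < int x}"
    using nondescent_count[of j x "{x..n}"] x assms by simp
  have "{u \<in> unused. u < int x} \<subseteq> 
      (!) (word_labels w) ` (nondescents w \<inter> {..j} - {j}) \<union> {int (w ! Suc j)}"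
  proof
    fix u assume "u \<in> {u \<in> unused. u < int x}"
    then obtain k where k: "k \<in> nondescents w" "u = leaf_label k" "u < int x"
      using nondescent_labels by auto
    have lt: "leaf_label k < leaf_label j" using k ge by (simp add: x_def)
    show "u \<in> (!) (word_labels w) ` (nondescents w \<inter> {..j} - {j}) \<union> {int (w ! Suc j)}"
    proof (cases "j < k")
      case True
      then show ?thesis using later_smaller_label[OF j k(1) _ lt] k by simp
    next
      case False
      then show ?thesis using k lt by (cases "k = j") auto
    qed
  qed
  then have "card {u \<in> unused. u < int x} \<le>
     card ((!) (word_labels w) ` (nondescents w \<inter> {..j} - {j}) \<union> {int (w ! Suc j)})"
    by (intro card_mono) auto
  also have "\<dots> \<le> card ((!) (word_labels w) ` (nondescents w \<inter> {..j} - {j})) + 1"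
    using card_Un_le[of _ "{int (w ! Suc j)}"] by simp
  also have "\<dots> \<le> card (nondescents w \<inter> {..j} - {j}) + 1"
    by (simp add: card_image_le)
  also have "\<dots> = card (nondescents w \<inter> {..j})"
    using j card_Suc_Diff1[of "nondescents w \<inter> {..j}" j] by simp
  finally show False using count by simp
qed

lemma well_placed: "well_placed w"
  unfolding well_placed_def
proof (intro allI impI)
  fix i assume i: "i < n"
  show "\<exists>j\<le>n. leaf_label j = int (w ! i) \<and> i \<le> j \<and>
        (\<forall>k<n. i \<le> k \<and> k \<le> j \<longrightarrow> w ! i \<le> w ! k)"
  proof (cases "\<exists>d\<in>descents w. w ! d = w ! i")
    case True
    then obtain d where d: "d \<in> descents w" "w ! d = w ! i" by auto
    have "i \<le> d" using descent_last[OF d(1) _ i] d by force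
    moreover have "w ! i \<le> w ! k" if "i \<le> k" "k \<le> d" for k
    proof (rule ccontr)
      assume "\<not> w ! i \<le> w ! k"
      then have less: "w ! k < w ! d" using d by simp
      then have "i < k" "k < d" using that d by (auto simp: less_le)
      moreover have "d < n" using d by (simp add: descents_def)
      ultimately show False using avoids_212 less d(2) unfolding avoids_2_1_2_def by metis
    qed
    ultimately show ?thesis using d leaf_label_descent[OF d(1)] 
      by (intro exI[of _ d]) (auto simp: descents_def)
  next
    case False
    then have "int (w ! i) \<in> unused" using letter_bounds[OF i] by (auto simp: unused_def)
    then obtain j where j: "j \<in> nondescents w" "leaf_label j = int (w ! i)"
      using nondescent_labels by (metis imageE)
    have "i \<le> j" using nondescent_label_less[OF j(1) _ i] j(2) by force
    moreover have "j \<le> n" using j(1) by (auto simp: nondescents_def)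
    moreover have "w ! i \<le> w ! k" if "i \<le> k" "k < n" for k
      using False descent_letter_if_smaller_later[of i k] that by (cases "i = k") force+
    ultimately show ?thesis using j by auto
  qed
qed

text \<open>
  In the slide labeling, \<open>h\<close> is the last unlabeled edge before \<open>i\<close> when edge \<open>i\<close> is to receive its
  letter.
\<close>

lemma slide_condition:
  assumes "h < i" "i < n" and le: "w ! h \<le> w ! i" 
    and between: "\<And>k. h < k \<Longrightarrow> k < i \<Longrightarrow> w ! i < w ! k"
    and s: "i \<le> s" "s \<le> n" "leaf_label s \<noteq> int (w ! i)"
  shows "leaf_label h \<le> leaf_label s"
proof -
  have "w ! h \<le> w ! Suc h" using le between[of "Suc h"] assms(1) by (cases "Suc h = i") auto
  then have h: "h \<in> nondescents w" using assms by (auto simp: nondescents_def)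
  consider "s \<in> descents w" | "s \<in> nondescents w" using descents_Un[OF nonempty] s by blast
  then show ?thesis
  proof cases
    case 1
    then show ?thesis using nondescent_label_less[OF h, of s] leaf_label_descent s assms
      by (auto simp: descents_def)
  next
    case 2
    show ?thesis
    proof (rule ccontr)
      assume "\<not> ?thesis"
      then have eq: "leaf_label s = int (w ! Suc h)" 
        using later_smaller_label[OF h 2] s assms by simp
      then have "Suc h < i" using s assms(1) by (cases "Suc h = i") auto
      then obtain d where "d \<in> descents w" "w ! d = w ! Suc h"
        using descent_letter_if_smaller_later[of "Suc h" i] between[of "Suc h"] assms by auto
      moreover have "leaf_label s \<in> unused" using nondescent_labels 2 by blast
      ultimately show False using eq unfolding unused_def by (metis DiffD2 image_eqI)
    qed
  qed
qed

end

context full_word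
begin

lemma well_placed_avoids_212:
  assumes inj: "inj_on ((!) (word_labels w)) {..n}" and wp: "well_placed w"
  shows "avoids_2_1_2 w"
  unfolding avoids_2_1_2_def
proof (rule notI, elim exE conjE)
  fix p q r assume pqr: "p < q" "q < r" "r < n" "w ! p = w ! r" "w ! q < w ! r"
  obtain j where j: "j \<le> n" "leaf_label j = int (w ! p)" 
      "\<forall>k<n. p \<le> k \<and> k \<le> j \<longrightarrow> w ! p \<le> w ! k"
    using wp pqr unfolding well_placed_def by (meson less_trans)
  obtain j' where j': "j' \<le> n" "leaf_label j' = int (w ! r)" "r \<le> j'"
    using wp pqr unfolding well_placed_def by meson
  have "j' = j" using j(1,2) j'(1,2) pqr(4) by (intro inj_onD[OF inj]) auto
  then have "w ! p \<le> w ! q" using j(3) j'(3) pqr(1-3) by simp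
  then show False using pqr(4,5) by simp
qed

lemma well_placed_avoids_23_bar2_1:
  assumes inj: "inj_on ((!) (word_labels w)) {..n}" and wp: "well_placed w"
  shows "avoids_23_bar2_1 w"
proof -
  interpret full_word_212 w
    using well_placed_avoids_212[OF assms] by unfold_locales
  \<comment> \<open>letters that are not descent letters and yet are followed by a smaller letter\<close>
  define bad where "bad = {l. int l \<in> unused \<and> (\<exists>p q. p < q \<and> q < n \<and> w ! p = l \<and> w ! q < l)}"
  have "bad = {}"
  proof (rule ccontr)
    assume "bad \<noteq> {}"
    have fin: "finite bad" by (rule finite_subset[of _ "{..n}"]) (auto simp: bad_def unused_def)
    define l where "l = Max bad"
    have "l \<in> bad" using Max_in[OF fin \<open>bad \<noteq> {}\<close>] by (simp add: l_def)
    then obtain p q where l: "int l \<in> unused" and pq: "p < q" "q < n" "w ! p = l" "w ! q < l"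
      by (auto simp: bad_def)
    obtain t where t: "t \<le> n" "leaf_label t = int l" "p \<le> t" 
      and above: "\<forall>k<n. p \<le> k \<and> k \<le> t \<longrightarrow> l \<le> w ! k"
      using wp pq unfolding well_placed_def by (metis less_trans)
    have "t < q" using above pq by (metis less_imp_le_nat not_le)
    have "t \<notin> descents w" using leaf_label_descent[of t] t l by (auto simp: unused_def)
    then have tn: "t \<in> nondescents w" using descents_Un[OF nonempty] t by auto
    have "l \<le> w ! t" using above t \<open>t < q\<close> pq by simp
    then have next_ge: "l \<le> w ! Suc t" using tn \<open>t < q\<close> pq by (auto simp: nondescents_def)
    have "insert (int l) {u \<in> unused. u < int l} \<subseteq> (!) (word_labels w) ` (nondescents w \<inter> {..t})"
    proof
      fix u assume u: "u \<in> insert (int l) {u \<in> unused. u < int l}"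
      then obtain k where k: "k \<in> nondescents w" "u = leaf_label k"
        using nondescent_labels l by auto
      have "k \<le> t"
      proof (rule ccontr)
        assume "\<not> k \<le> t"
        moreover have "u \<noteq> int l"
        proof
          assume "u = int l"
          then have "k = t" using inj_on_nondescents k t tn by (metis inj_onD)
          then show False using \<open>\<not> k \<le> t\<close> by simp
        qed
        ultimately show False using later_smaller_label[OF tn k(1)] u k t next_ge by auto
      qed
      then show "u \<in> (!) (word_labels w) ` (nondescents w \<inter> {..t})" using k by auto
    qed
    then have "card (insert (int l) {u \<in> unused. u < int l}) \<le> card (nondescents w \<inter> {..t})"
      by (intro surj_card_le) simp_all
    then have more: "card {u \<in> unused. u < int l} < card (nondescents w \<inter> {..t})"
      by simp
    have "l \<in> set w" using pq by (metis less_trans nth_mem)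
    have "{Suc l..n} \<subseteq> seen_or_closed t"
    proof
      fix e assume e: "e \<in> {Suc l..n}"
      then obtain i where i: "i < n" "w ! i = e"
        using upward_closed[OF \<open>l \<in> set w\<close>, of e] by (auto simp: in_set_conv_nth)
      show "e \<in> seen_or_closed t"
      proof (cases "t < i")
        case True
        then show ?thesis using i by (auto simp: seen_or_closed_def)
      next
        case False
        have "e \<notin> bad" using Max_ge[OF fin, of e] e by (auto simp: l_def)
        moreover have "i < q" "w ! q < e" using False \<open>t < q\<close> pq(4) e by auto
        ultimately have "int e \<notin> unused" using i(2) pq(2) unfolding bad_def by blast
        then obtain d where "d \<in> descents w" "w ! d = e" using e by (auto simp: unused_def)
        then show ?thesis by (cases "d \<le> t") (auto simp: seen_or_closed_def descents_def)
      qed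
    qed
    then have "card (nondescents w \<inter> {..t}) + card {Suc l..n} + l \<le> 
        n + card {u \<in> unused. u < int l}"
      using pq letter_bounds[of p] \<open>t < q\<close> by (intro nondescent_count) auto
    then show False using more pq letter_bounds[of p] by simp
  qed
  show ?thesis unfolding avoids_23_bar2_1_def
  proof (intro allI impI, elim conjE, rule ccontr)
    fix p q assume pq: "p + 1 < q" "q < n" "w ! q < w ! p" "w ! p < w ! (p + 1)"
      and none: "\<not> (\<exists>s. p + 1 < s \<and> s < q \<and> w ! s = w ! p)"
    have "w ! d \<noteq> w ! p" if d: "d \<in> descents w" for d
    proof
      assume eq: "w ! d = w ! p"
      have "d \<noteq> p" using pq d by (auto simp: descents_def)
      moreover have "\<not> d < p" using descent_last[OF d, of p] eq pq by auto
      moreover have "d \<noteq> q" "d \<noteq> p + 1" using eq pq by auto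
      moreover have "\<not> (p + 1 < d \<and> d < q)" using none eq by blast
      ultimately have "q < d" by linarith
      moreover have "p < q" "d < n" using pq d by (auto simp: descents_def)
      ultimately show False using avoids_212 pq(3) eq unfolding avoids_2_1_2_def by metis
    qed
    then have "int (w ! p) \<in> unused" using letter_bounds[of p] pq by (fastforce simp: unused_def)
    moreover have "p < q" using pq by simp
    ultimately have "w ! p \<in> bad" unfolding bad_def using pq(2,3) by blast
    then show False using \<open>bad = {}\<close> by simp
  qed
qed

end

section \<open>The tree of a word as a graph\<close>

lemma path_edges_simps [simp]:
  "path_edges [] = []" "path_edges [u] = []"
  "path_edges (u # v # p) = {u, v} # path_edges (v # p)"
  by (simp_all add: path_edges_def)

lemma path_edges_snoc:
  "p \<noteq> [] \<Longrightarrow> set (path_edges (p @ [v])) = insert {last p, v} (set (path_edges p))"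
  by (induction p rule: induct_list012) auto

lemma path_edges_take_subset: "set (path_edges (take k p)) \<subseteq> set (path_edges p)"
proof (induction p arbitrary: k rule: induct_list012)
  case (3 u v p)
  show ?case
  proof (cases k)
    case (Suc k')
    then show ?thesis using "3.IH"(2)[of k'] by (cases k') auto
  qed simp
qed (auto simp: take_Cons')

lemma rtrancl_imp_path:
  assumes "(u, v) \<in> {(s, t). {s, t} \<in> E \<and> Q s \<and> Q t}\<^sup>*" (is "_ \<in> ?r\<^sup>*")
  shows "\<exists>p. p \<noteq> [] \<and> hd p = u \<and> last p = v \<and> distinct p \<and> set (path_edges p) \<subseteq> E \<and>
    (\<forall>y\<in>set p. (u, y) \<in> ?r\<^sup>*)"
  using assms
proof (induction rule: rtrancl_induct)
  case base
  show ?case by (intro exI[of _ "[u]"]) auto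
next
  case (step y z)
  then obtain p where p: "p \<noteq> []" "hd p = u" "last p = y" "distinct p"
    "set (path_edges p) \<subseteq> E" "\<forall>y\<in>set p. (u, y) \<in> ?r\<^sup>*" by blast
  show ?case
  proof (cases "z \<in> set p")
    case True
    then obtain k where k: "k < length p" "p ! k = z" by (auto simp: in_set_conv_nth)
    show ?thesis
    proof (intro exI[of _ "take (Suc k) p"] conjI)
      show "set (path_edges (take (Suc k) p)) \<subseteq> E"
        using path_edges_take_subset p(5) by blast
      show "last (take (Suc k) p) = z" using k by (simp add: take_Suc_conv_app_nth)
      show "\<forall>y\<in>set (take (Suc k) p). (u, y) \<in> ?r\<^sup>*"
        using p(6) by (auto dest: in_set_takeD)
    qed (use p in \<open>auto\<close>)
  next
    case False
    have "(u, z) \<in> ?r\<^sup>*" using step by (meson rtrancl.rtrancl_into_rtrancl)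
    then show ?thesis using False p step
      by (intro exI[of _ "p @ [z]"]) (auto simp: path_edges_snoc)
  qed
qed

lemma path_edges_nth: "Suc k < length p \<Longrightarrow> path_edges p ! k = {p ! k, p ! Suc k}"
  by (simp add: path_edges_def nth_tl)

lemma length_path_edges: "length (path_edges p) = length p - 1"
  by (simp add: path_edges_def)

text \<open>
  A height function in which adjacent vertices differ and every vertex has at most one lower
  neighbour excludes cycles: a highest vertex of a cycle would have two lower neighbours.
\<close>

lemma no_cycle_if_unique_lower_neighbour:
  fixes h :: "'v \<Rightarrow> nat"
  assumes neq: "\<And>u v. {u, v} \<in> edges T \<Longrightarrow> h u \<noteq> h v"
    and unique: "\<And>u u' v. {u, v} \<in> edges T \<Longrightarrow> {u', v} \<in> edges T \<Longrightarrow>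
      h u < h v \<Longrightarrow> h u' < h v \<Longrightarrow> u = u'"
  shows "\<not> (\<exists>p. is_path T p \<and> length p \<ge> 3 \<and> {last p, hd p} \<in> edges T)"
proof (rule notI, elim exE conjE)
  fix p assume path: "is_path T p" and len: "length p \<ge> 3" and close: "{last p, hd p} \<in> edges T"
  define m where "m = length p"
  have adj: "{p ! k, p ! Suc k} \<in> edges T" if "Suc k < m" for k
    using path that path_edges_nth[of k p] nth_mem[of k "path_edges p"] 
    unfolding is_path_def m_def by (auto simp: length_path_edges)
  have cl: "{p ! (m - 1), p ! 0} \<in> edges T"
  proof -
    have "p \<noteq> []" using len by auto
    then show ?thesis using close by (simp add: m_def last_conv_nth hd_conv_nth)
  qed
  obtain k where k: "k < m" "\<And>i. i < m \<Longrightarrow> h (p ! i) \<le> h (p ! k)"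
  proof -
    have "finite ((\<lambda>i. h (p ! i)) ` {..<m})" "(\<lambda>i. h (p ! i)) ` {..<m} \<noteq> {}" 
      using len by (auto simp: m_def lessThan_empty_iff)
    then have "Max ((\<lambda>i. h (p ! i)) ` {..<m}) \<in> (\<lambda>i. h (p ! i)) ` {..<m}" by (rule Max_in)
    then obtain k where "k < m" "Max ((\<lambda>i. h (p ! i)) ` {..<m}) = h (p ! k)" by auto
    then show ?thesis using that[of k] by (metis Max_ge finite_imageI finite_lessThan imageI lessThan_iff)
  qed
  define k1 where "k1 = (if k = 0 then m - 1 else k - 1)"
  define k2 where "k2 = (if Suc k = m then 0 else Suc k)"
  have m3: "m \<ge> 3" using len by (simp add: m_def)
  have e1: "{p ! k1, p ! k} \<in> edges T" 
    using cl adj[of "k - 1"] k(1) by (auto simp: k1_def)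
  have e2: "{p ! k2, p ! k} \<in> edges T" 
    using cl adj[of k] k(1) by (auto simp: k2_def insert_commute)
  have r: "k1 < m" "k2 < m" "k1 \<noteq> k2" using m3 k(1) by (auto simp: k1_def k2_def)
  have "h (p ! k1) < h (p ! k)" "h (p ! k2) < h (p ! k)"
    using k(2)[of k1] k(2)[of k2] neq[OF e1] neq[OF e2] r by auto
  then have "p ! k1 = p ! k2" using unique e1 e2 by blast
  moreover have "distinct p" using path by (simp add: is_path_def)
  ultimately show False using r by (simp add: m_def nth_eq_iff_index_eq)
qed

context nonempty_word
begin

abbreviation "T \<equiv> tree_of_word w"

text \<open>
  The internal edge that carries the letter \<open>w ! i\<close>.
\<close>

definition spine_edge :: "nat \<Rightarrow> cat_vertex set" where
  "spine_edge i = {Spine i, Spine (Suc i)}"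

text \<open>The leaves of the tree of the word, as \<open>leaves_T\<close> confirms.\<close>

definition leaf_verts :: "cat_vertex set" where
  "leaf_verts = {Leaf_a, Leaf_b} \<union> (\<lambda>j. Leaf (Suc j)) ` {..n}"

text \<open>
  The index of a spine vertex, and for a leaf that of its neighbour. Since \<open>Leaf (n + 1)\<close> shares its
  neighbour with \<open>Leaf n\<close>, the index of a numbered leaf is capped at \<open>n\<close>.
\<close>

primrec pos :: "cat_vertex \<Rightarrow> nat" where
  "pos (Spine i) = i"
| "pos Leaf_a = 0"
| "pos Leaf_b = 0"
| "pos (Leaf j) = min j n"

lemma Leaf_mem: "j \<le> n \<Longrightarrow> Leaf (Suc j) \<in> leaf_verts" "Leaf_a \<in> leaf_verts" "Leaf_b \<in> leaf_verts"
  by (auto simp: leaf_verts_def)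

lemma verts_T: "verts T = Spine ` {..n} \<union> leaf_verts"
proof -
  have "Leaf ` {1..n + 1} = (\<lambda>j. Leaf (Suc j)) ` {..n}"
    by (auto simp: image_iff) (metis Suc_le_D Suc_le_mono atMost_iff)
  then show ?thesis by (auto simp: tree_of_word_def Let_def leaf_verts_def)
qed

lemma edges_T: "edges T = spine_edge ` {..<n} \<union> (\<lambda>x. {x, Spine (pos x)}) ` leaf_verts"
proof (intro set_eqI iffI)
  fix e assume "e \<in> edges T"
  then consider i where "i < n" "e = {Spine i, Spine (i + 1)}"
    | "e = {Spine 0, Leaf_a}" | "e = {Spine 0, Leaf_b}"
    | i where "1 \<le> i" "i \<le> n" "e = {Spine i, Leaf i}"
    | "e = {Spine n, Leaf (n + 1)}"
    by (auto simp: tree_of_word_def Let_def)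
  then show "e \<in> spine_edge ` {..<n} \<union> (\<lambda>x. {x, Spine (pos x)}) ` leaf_verts"
  proof cases
    case 1
    then show ?thesis by (auto simp: spine_edge_def)
  next
    case (4 i)
    then have "e = (\<lambda>x. {x, Spine (pos x)}) (Leaf (Suc (i - 1)))" by auto
    then show ?thesis using Leaf_mem(1)[of "i - 1"] 4(2) by (intro UnI2) (rule image_eqI, assumption, simp)
  next
    case 2
    then have "e = (\<lambda>x. {x, Spine (pos x)}) Leaf_a" by auto
    then show ?thesis using Leaf_mem by (intro UnI2) (rule image_eqI, assumption, simp)
  next
    case 3
    then have "e = (\<lambda>x. {x, Spine (pos x)}) Leaf_b" by auto
    then show ?thesis using Leaf_mem by (intro UnI2) (rule image_eqI, assumption, simp)
  next
    case 5
    then have "e = (\<lambda>x. {x, Spine (pos x)}) (Leaf (Suc n))" by auto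
    then show ?thesis using Leaf_mem by (intro UnI2) (rule image_eqI, assumption, simp)
  qed
next
  fix e assume "e \<in> spine_edge ` {..<n} \<union> (\<lambda>x. {x, Spine (pos x)}) ` leaf_verts"
  then consider i where "i < n" "e = spine_edge i" | x where "x \<in> leaf_verts" "e = {x, Spine (pos x)}"
    by auto
  then show "e \<in> edges T"
  proof cases
    case 1
    then show ?thesis by (auto simp: tree_of_word_def Let_def spine_edge_def)
  next
    case (2 x)
    then consider "x = Leaf_a" | "x = Leaf_b" | j where "j < n" "x = Leaf (Suc j)" | "x = Leaf (Suc n)"
      by (auto simp: leaf_verts_def le_less)
    then show ?thesis
      by cases (use 2 in \<open>auto simp: tree_of_word_def Let_def insert_commute\<close>)
  qed
qed

lemma leaf_verts_Spine [simp]: "Spine i \<notin> leaf_verts"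
  by (auto simp: leaf_verts_def)

lemma leaf_neq_Spine: "x \<in> leaf_verts \<Longrightarrow> x \<noteq> Spine i \<and> Spine i \<noteq> x"
  by auto

lemma spine_edge_neq_leaf_edge: "x \<in> leaf_verts \<Longrightarrow> spine_edge k \<noteq> {x, y}"
  unfolding spine_edge_def by (metis insertCI insertE leaf_verts_Spine singletonD)

lemma leaf_edge: 
  assumes "x \<in> leaf_verts" "{x, y} \<in> edges T"
  shows "y = Spine (pos x)"
proof -
  have "{x, y} \<notin> spine_edge ` {..<n}"
    using spine_edge_neq_leaf_edge[OF assms(1), of _ y] by fastforce
  then have "{x, y} \<in> (\<lambda>x. {x, Spine (pos x)}) ` leaf_verts"
    using assms(2) by (simp add: edges_T)
  then obtain z where "{x, y} = {z, Spine (pos z)}" by (rule imageE)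
  then show ?thesis using leaf_neq_Spine[OF assms(1)] by (metis doubleton_eq_iff)
qed

lemma edges_T_cases:
  assumes "{u, v} \<in> edges T"
  obtains i where "i < n" "u = Spine i" "v = Spine (Suc i)"
  | i where "i < n" "v = Spine i" "u = Spine (Suc i)"
  | "u \<in> leaf_verts" "v = Spine (pos u)"
  | "v \<in> leaf_verts" "u = Spine (pos v)"
proof -
  have "{u, v} \<in> spine_edge ` {..<n} \<or> {u, v} \<in> (\<lambda>x. {x, Spine (pos x)}) ` leaf_verts"
    using assms by (simp add: edges_T)
  then show ?thesis using that by (auto simp: spine_edge_def doubleton_eq_iff)
qed

lemma lab_T: "lab T = cat_label w"
  by (simp add: tree_of_word_def Let_def)

lemma finite_leaf_verts [simp]: "finite leaf_verts"
  by (simp add: leaf_verts_def)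

lemma pos_le: "x \<in> leaf_verts \<Longrightarrow> pos x \<le> n"
  by (auto simp: leaf_verts_def)

lemma inj_spine_edge: "spine_edge i = spine_edge j \<longleftrightarrow> i = j"
  by (auto simp: spine_edge_def doubleton_eq_iff)

lemma degree_leaf: "x \<in> leaf_verts \<Longrightarrow> degree T x = 1"
proof -
  assume "x \<in> leaf_verts"
  then have "{e \<in> edges T. x \<in> e} = {{x, Spine (pos x)}}"
    by (auto simp: edges_T spine_edge_def)
  then show ?thesis by (simp add: degree_def)
qed

lemma degree_Spine: assumes "i \<le> n" shows "degree T (Spine i) = 3"
proof -
  define A where "A = {x \<in> leaf_verts. pos x = i}"
  have eq: "{e \<in> edges T. Spine i \<in> e} =
      spine_edge ` {k. k < n \<and> (k = i \<or> Suc k = i)} \<union> (\<lambda>x. {x, Spine (pos x)}) ` A"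
    by (auto simp: edges_T spine_edge_def A_def)
  have "inj_on (\<lambda>x. {x, Spine (pos x)}) A"
    by (auto simp: inj_on_def A_def doubleton_eq_iff)
  moreover have "inj_on spine_edge B" for B by (simp add: inj_on_def inj_spine_edge)
  moreover have "spine_edge ` {k. k < n \<and> (k = i \<or> Suc k = i)} \<inter> (\<lambda>x. {x, Spine (pos x)}) ` A = {}"
    using spine_edge_neq_leaf_edge by (auto simp: A_def)
  moreover have "finite A" by (simp add: A_def)
  ultimately have deg: "degree T (Spine i) = card {k. k < n \<and> (k = i \<or> Suc k = i)} + card A"
    unfolding degree_def eq by (subst card_Un_disjoint) (auto simp: card_image)
  consider "i = 0" | "0 < i" "i < n" | "0 < i" "i = n" using assms by linarith
  then show ?thesis
  proof cases
    case 1
    then have "A = {Leaf_a, Leaf_b}" using n_pos by (auto simp: A_def leaf_verts_def min_def split: if_splits)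
    moreover have "{k. k < n \<and> (k = i \<or> Suc k = i)} = {0}" using 1 n_pos by auto
    ultimately show ?thesis using deg by simp
  next
    case 2
    have "A = (\<lambda>j. Leaf (Suc j)) ` {j. j \<le> n \<and> min (Suc j) n = i}"
      using 2 by (auto simp: A_def leaf_verts_def)
    moreover have "{j. j \<le> n \<and> min (Suc j) n = i} = {i - 1}" using 2 by auto
    ultimately have "A = {Leaf i}" using 2 by simp
    moreover have "{k. k < n \<and> (k = i \<or> Suc k = i)} = {i - 1, i}" using 2 by auto
    ultimately show ?thesis using deg 2 by simp
  next
    case 3
    have "A = (\<lambda>j. Leaf (Suc j)) ` {j. j \<le> n \<and> min (Suc j) n = i}"
      using 3 by (auto simp: A_def leaf_verts_def)
    moreover have "{j. j \<le> n \<and> min (Suc j) n = i} = {n - 1, n}" using 3 by auto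
    ultimately have "A = {Leaf n, Leaf (Suc n)}" using 3 by simp
    moreover have "{k. k < n \<and> (k = i \<or> Suc k = i)} = {n - 1}" using 3 by auto
    ultimately show ?thesis using deg by simp
  qed
qed

lemma leaves_T: "leaves T = leaf_verts"
  using degree_leaf degree_Spine by (auto simp: leaves_def verts_T)

lemma internal_edges_T: "internal_edges T = spine_edge ` {..<n}"
  by (auto simp: internal_edges_def leaves_T edges_T) (auto simp: spine_edge_def)

lemma is_tree_T: "is_tree T"
  unfolding is_tree_def
proof (intro conjI)
  show "finite (verts T)" "verts T \<noteq> {}" by (auto simp: verts_T)
  show "\<forall>e\<in>edges T. e \<subseteq> verts T \<and> card e = 2"
    using pos_le by (auto simp: edges_T verts_T spine_edge_def card_insert_if leaf_neq_Spine)
  let ?r = "{(s, t). {s, t} \<in> edges T \<and> True \<and> True}"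
  have sym: "sym (?r\<^sup>*)" by (intro sym_rtrancl symI) (auto simp: insert_commute)
  have spine: "(Spine 0, Spine i) \<in> ?r\<^sup>*" if "i \<le> n" for i
    using that
  proof (induction i)
    case (Suc i)
    then have "(Spine i, Spine (Suc i)) \<in> ?r" by (auto simp: edges_T spine_edge_def)
    then show ?case using Suc by (meson Suc_leD rtrancl.rtrancl_into_rtrancl)
  qed simp
  have all: "(Spine 0, v) \<in> ?r\<^sup>*" if v: "v \<in> verts T" for v
  proof (cases "v \<in> leaf_verts")
    case True
    then have "(Spine (pos v), v) \<in> ?r" by (auto simp: edges_T insert_commute)
    then show ?thesis using spine[OF pos_le[OF True]] by (meson rtrancl.rtrancl_into_rtrancl)
  next
    case False
    then show ?thesis using v spine by (auto simp: verts_T)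
  qed
  have stay: "y \<in> verts T" if "u \<in> verts T" "(u, y) \<in> ?r\<^sup>*" for u y
    using that(2,1) pos_le
    by (induction rule: rtrancl_induct) 
      (auto simp: verts_T edges_T spine_edge_def doubleton_eq_iff)
  show "\<forall>u\<in>verts T. \<forall>v\<in>verts T. \<exists>p. is_path T p \<and> hd p = u \<and> last p = v"
  proof (intro ballI)
    fix u v assume u: "u \<in> verts T" and v: "v \<in> verts T"
    have "(u, v) \<in> ?r\<^sup>*" using symD[OF sym all[OF u]] all[OF v] by (rule rtrancl_trans)
    from rtrancl_imp_path[OF this] show "\<exists>p. is_path T p \<and> hd p = u \<and> last p = v"
      using stay[OF u] unfolding is_path_def by blast
  qed
  \<comment> \<open>the height is the distance from the root, except that all leaves are above the spine\<close>
  let ?h = "\<lambda>v. if v \<in> leaf_verts then Suc n else pos v"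
  show "\<not> (\<exists>p. is_path T p \<and> length p \<ge> 3 \<and> {last p, hd p} \<in> edges T)"
  proof (rule no_cycle_if_unique_lower_neighbour[where h = ?h])
    fix u v assume "{u, v} \<in> edges T"
    then show "?h u \<noteq> ?h v"
      by (cases rule: edges_T_cases) (use pos_le in \<open>fastforce+\<close>)
  next
    have lower: "u = Spine (if v \<in> leaf_verts then pos v else pos v - 1)" 
      if "{u, v} \<in> edges T" "?h u < ?h v" for u v
      using that(1) by (cases rule: edges_T_cases) (use that(2) pos_le[of u] in auto)
    fix u u' v assume "{u, v} \<in> edges T" "{u', v} \<in> edges T" "?h u < ?h v" "?h u' < ?h v"
    then show "u = u'" using lower by metis
  qed
qed

lemma path_edges_map_Spine: "path_edges (map Spine [0..<Suc n]) = map spine_edge [0..<n]"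
  by (intro nth_equalityI) (simp_all add: length_path_edges path_edges_nth spine_edge_def del: upt_Suc)

lemma caterpillar_spine_T: "caterpillar_spine T (map Spine [0..<Suc n])"
  unfolding caterpillar_spine_def
proof (intro conjI)
  show "is_tree T" by (rule is_tree_T)
  show "\<forall>v\<in>verts T - leaves T. degree T v = 3" 
    using degree_Spine by (auto simp: leaves_T verts_T)
  show "set (path_edges (map Spine [0..<Suc n])) = internal_edges T"
    unfolding path_edges_map_Spine internal_edges_T by auto
  show "is_path T (map Spine [0..<Suc n])"
    unfolding is_path_def path_edges_map_Spine 
    by (auto simp: distinct_map verts_T edges_T inj_on_def simp del: upt_Suc)
  have "hd (map Spine [0..<Suc n]) = Spine 0" by (simp add: hd_map del: upt_Suc)
  then show "\<exists>x\<in>leaves T. lab T x = label_a \<and> {x, hd (map Spine [0..<Suc n])} \<in> edges T"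
    "\<exists>x\<in>leaves T. lab T x = label_b \<and> {x, hd (map Spine [0..<Suc n])} \<in> edges T"
    by (auto simp: leaves_T lab_T edges_T leaf_verts_def simp del: upt_Suc)
qed

end

text \<open>
  The word trees with the right leaf labels, that is, those that are stable trees.
\<close>

locale labelled_word_tree = nonempty_word +
  assumes bij_label: "bij_betw (cat_label w) leaf_verts {label_a..int n}"
begin

lemma label_inj: "x \<in> leaf_verts \<Longrightarrow> y \<in> leaf_verts \<Longrightarrow> cat_label w x = cat_label w y \<Longrightarrow> x = y"
  using bij_label by (auto simp: bij_betw_def dest: inj_onD)

lemma leaf_label_nonneg: 
  assumes "j \<le> n" shows "0 \<le> leaf_label j"
proof -
  have "cat_label w (Leaf (Suc j)) \<in> {label_a..int n}"
    using bij_label Leaf_mem(1)[OF assms] by (rule bij_betw_apply)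
  moreover have "cat_label w (Leaf (Suc j)) \<noteq> cat_label w Leaf_a" 
    "cat_label w (Leaf (Suc j)) \<noteq> cat_label w Leaf_b"
    using label_inj Leaf_mem(2,3) Leaf_mem(1)[OF assms] by blast+
  ultimately show ?thesis by auto
qed

lemma leaf_label_inj: "i \<le> n \<Longrightarrow> j \<le> n \<Longrightarrow> leaf_label i = leaf_label j \<Longrightarrow> i = j"
  using label_inj[of "Leaf (Suc i)" "Leaf (Suc j)"] Leaf_mem(1) by auto

lemma leaf_labelled_a: "x \<in> leaf_verts \<Longrightarrow> cat_label w x = label_a \<Longrightarrow> x = Leaf_a"
  using label_inj[of x Leaf_a] Leaf_mem(2) by auto

lemma leaf_labelled_nat: 
  assumes "x \<in> leaf_verts" "cat_label w x = int l"
  obtains j where "j \<le> n" "x = Leaf (Suc j)" "leaf_label j = int l"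
  using assms by (auto simp: leaf_verts_def)

lemma stable_tree_T: "stable_tree n T"
  using is_tree_T degree_Spine bij_label by (auto simp: stable_tree_def leaves_T lab_T verts_T)

text \<open>
  The spine has only one orientation, because its first vertex is adjacent to the leaf labeled \<open>a\<close>.
\<close>

lemma caterpillar_spine_unique:
  assumes "caterpillar_spine T vs"
  shows "vs = map Spine [0..<Suc n]"
proof -
  have path: "vs \<noteq> []" "distinct vs" "set vs \<subseteq> verts T" 
    and internal: "set (path_edges vs) = spine_edge ` {..<n}"
    using assms by (auto simp: caterpillar_spine_def is_path_def internal_edges_T)
  obtain x where "x \<in> leaf_verts" "cat_label w x = label_a" "{x, hd vs} \<in> edges T"
    using assms by (auto simp: caterpillar_spine_def leaves_T lab_T)
  then have "{Leaf_a, hd vs} \<in> edges T" using leaf_labelled_a by auto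
  then have hd: "hd vs = Spine 0"
    using leaf_edge[OF Leaf_mem(2)] by simp
  have nth: "vs ! k = Spine k" if "k < length vs" for k
    using that
  proof (induction k rule: less_induct)
    case (less k)
    show ?case
    proof (cases k)
      case 0
      then show ?thesis using hd path by (simp add: hd_conv_nth)
    next
      case (Suc i)
      have "path_edges vs ! i \<in> set (path_edges vs)"
        using less Suc by (intro nth_mem) (simp add: length_path_edges)
      then have "{Spine i, vs ! Suc i} \<in> spine_edge ` {..<n}"
        using less Suc internal by (simp add: path_edges_nth)
      then have "vs ! Suc i = Spine (Suc i) \<or> (\<exists>h. i = Suc h \<and> vs ! Suc i = Spine h)"
        by (auto simp: spine_edge_def doubleton_eq_iff)
      moreover have False if "i = Suc h" "vs ! Suc i = Spine h" for h
      proof -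
        have "vs ! Suc i = vs ! h" using less that Suc by simp
        then show False using path(2) less(2) that Suc by (simp add: nth_eq_iff_index_eq)
      qed
      ultimately show ?thesis using Suc by auto
    qed
  qed
  have "length vs \<le> Suc n"
  proof (rule ccontr)
    assume "\<not> ?thesis"
    then have "Spine (Suc n) \<in> set vs" using nth[of "Suc n"] nth_mem[of "Suc n" vs] by simp
    then show False using path(3) by (auto simp: verts_T)
  qed
  moreover have "spine_edge (n - 1) \<in> set (path_edges vs)" using internal n_pos by auto
  then obtain k where "k < length vs - 1" "path_edges vs ! k = spine_edge (n - 1)"
    by (auto simp: in_set_conv_nth length_path_edges)
  then have "{Spine k, Spine (Suc k)} = spine_edge (n - 1)" "Suc k < length vs"
    using nth[of k] nth[of "Suc k"] by (simp_all add: path_edges_nth)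
  then have "n < length vs" 
    using inj_spine_edge[of k "n - 1"] unfolding spine_edge_def[of k, symmetric] by simp
  ultimately have "length vs = Suc n" by simp
  then show ?thesis using nth by (intro nth_equalityI) (simp_all del: upt_Suc)
qed

lemma has_edge_word_iff: "has_edge_word T M w \<longleftrightarrow> (\<forall>i<n. M (spine_edge i) = Some (w ! i))"
proof -
  have "has_edge_word T M w \<longleftrightarrow> map M (path_edges (map Spine [0..<Suc n])) = map Some w"
    using caterpillar_spine_unique caterpillar_spine_T unfolding has_edge_word_def by metis
  then show ?thesis unfolding path_edges_map_Spine 
    using list_eq_iff_nth_eq[of "map M (map spine_edge [0..<n])" "map Some w"] by simp
qed

end

lemma (in nonempty_word) bij_betw_cat_label:
  assumes "bij_betw ((!) (word_labels w)) {..n} {0..int n}"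
  shows "bij_betw (cat_label w) leaf_verts {label_a..int n}"
proof -
  have "inj_on (\<lambda>j. Leaf (Suc j)) {..n}" by (auto simp: inj_on_def)
  then have "bij_betw (\<lambda>j. Leaf (Suc j)) {..n} ((\<lambda>j. Leaf (Suc j)) ` {..n})"
    by (rule inj_on_imp_bij_betw)
  moreover have "bij_betw (cat_label w \<circ> (\<lambda>j. Leaf (Suc j))) {..n} {0..int n}"
    using assms by (simp add: comp_def)
  ultimately have "bij_betw (cat_label w) ((\<lambda>j. Leaf (Suc j)) ` {..n}) {0..int n}"
    by (simp add: bij_betw_comp_iff)
  moreover have "bij_betw (cat_label w) {Leaf_a, Leaf_b} {label_a, label_b}"
    by (auto simp: bij_betw_def)
  ultimately have "bij_betw (cat_label w) ({Leaf_a, Leaf_b} \<union> (\<lambda>j. Leaf (Suc j)) ` {..n})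
     ({label_a, label_b} \<union> {0..int n})"
    by (intro bij_betw_combine) auto
  moreover have "{label_a, label_b} \<union> {0..int n} = {label_a..int n}" by auto
  ultimately show ?thesis by (simp add: leaf_verts_def)
qed

section \<open>Contractions and slide steps\<close>

text \<open>
  A stage of the slide labeling: \<open>F\<close> is the set of indices of the spine edges labeled so far.
\<close>

locale contracted_word_tree = labelled_word_tree +
  fixes F :: "nat set"
  assumes F_subset: "F \<subseteq> {..<n}"
begin

abbreviation "cls \<equiv> contract_class (spine_edge ` F)"
abbreviation "C \<equiv> contract (spine_edge ` F) T"

lemma refl_cls: "v \<in> cls v"
  by (simp add: contract_class_def)

lemma cls_eqI: "u \<in> cls v \<Longrightarrow> cls u = cls v"
proof -
  let ?r = "{(s, t). {s, t} \<in> spine_edge ` F}"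
  assume "u \<in> cls v"
  then have vu: "(v, u) \<in> ?r\<^sup>*" by (simp add: contract_class_def)
  have "sym (?r\<^sup>*)" by (intro sym_rtrancl symI) (auto simp: insert_commute)
  then have "(u, v) \<in> ?r\<^sup>*" using vu by (rule symD)
  then show ?thesis using vu by (auto simp: contract_class_def intro: rtrancl_trans)
qed

lemma cls_leaf: "x \<in> leaf_verts \<Longrightarrow> cls x = {x}"
proof -
  assume x: "x \<in> leaf_verts"
  have "y = x" if "(x, y) \<in> {(s, t). {s, t} \<in> spine_edge ` F}\<^sup>*" for y
    using that
  proof (cases rule: converse_rtranclE)
    case (step z)
    then show ?thesis using spine_edge_neq_leaf_edge[OF x, of _ z] by fastforce
  qed simp
  then show ?thesis by (auto simp: contract_class_def)
qed

lemma cls_step: "k \<in> F \<Longrightarrow> cls (Spine k) = cls (Spine (Suc k))"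
  by (rule cls_eqI[symmetric]) (auto simp: contract_class_def spine_edge_def)

lemma cls_interval: "i \<le> j \<Longrightarrow> {i..<j} \<subseteq> F \<Longrightarrow> cls (Spine i) = cls (Spine j)"
proof (induction rule: dec_induct)
  case (step k)
  then show ?case using cls_step[of k] by (auto simp: subset_iff)
qed simp

lemma cls_Spine_subset: 
  assumes "y \<in> cls (Spine i)"
  shows "\<exists>j. y = Spine j \<and> {i..<j} \<subseteq> F \<and> {j..<i} \<subseteq> F"
proof -
  have "(Spine i, y) \<in> {(s, t). {s, t} \<in> spine_edge ` F}\<^sup>*" 
    using assms by (simp add: contract_class_def)
  then show ?thesis
  proof (induction rule: rtrancl_induct)
    case (step y z)
    then obtain j where j: "y = Spine j" "{i..<j} \<subseteq> F" "{j..<i} \<subseteq> F" by auto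
    from step(2) obtain k where k: "k \<in> F" "{y, z} = {Spine k, Spine (Suc k)}" 
      by (auto simp: spine_edge_def)
    then consider "j = k" "z = Spine (Suc k)" | "j = Suc k" "z = Spine k"
      using j(1) by (auto simp: doubleton_eq_iff)
    then show ?case
    proof cases
      case 1
      have "{i..<Suc k} \<subseteq> insert k {i..<k}" "{Suc k..<i} \<subseteq> {k..<i}" by auto
      then show ?thesis using 1 j k by blast
    next
      case 2
      have "{i..<k} \<subseteq> {i..<Suc k}" "{k..<i} \<subseteq> insert k {Suc k..<i}" by auto
      then show ?thesis using 2 j k by blast
    qed
  qed auto
qed

lemma cls_Spine_eqD:
  assumes "cls (Spine i) = cls (Spine j)" shows "{i..<j} \<subseteq> F" "{j..<i} \<subseteq> F"
  using cls_Spine_subset[of "Spine j" i] refl_cls[of "Spine j"] assms by auto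

lemma cls_separated: "k \<le> i \<Longrightarrow> i < j \<Longrightarrow> i \<notin> F \<Longrightarrow> cls (Spine k) \<noteq> cls (Spine j)"
  by (meson atLeastLessThan_iff cls_Spine_eqD(1) subsetD)

lemma cls_Spine_neq_leaf: "x \<in> leaf_verts \<Longrightarrow> cls (Spine i) \<noteq> {x}"
  using refl_cls[of "Spine i"] by auto

lemma verts_C: "verts C = cls ` Spine ` {..n} \<union> (\<lambda>x. {x}) ` leaf_verts"
proof -
  have "cls ` leaf_verts = (\<lambda>x. {x}) ` leaf_verts" by (rule image_cong) (simp_all add: cls_leaf)
  then show ?thesis by (simp add: contract_def verts_T image_Un)
qed

lemma edges_C: 
  "edges C = (\<lambda>i. {cls (Spine i), cls (Spine (Suc i))}) ` ({..<n} - F) \<union>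
     (\<lambda>x. {{x}, cls (Spine (pos x))}) ` leaf_verts"
proof -
  have "edges T - spine_edge ` F = 
      spine_edge ` ({..<n} - F) \<union> (\<lambda>x. {x, Spine (pos x)}) ` leaf_verts"
    using F_subset spine_edge_neq_leaf_edge 
    by (auto simp: edges_T inj_spine_edge)
  moreover have "(\<lambda>x. cls ` {x, Spine (pos x)}) ` leaf_verts = 
      (\<lambda>x. {{x}, cls (Spine (pos x))}) ` leaf_verts"
    by (rule image_cong) (simp_all add: cls_leaf)
  ultimately show ?thesis 
    by (simp add: contract_def image_Un image_image) (simp add: spine_edge_def)
qed

lemma edges_C_cases:
  assumes "{X, Y} \<in> edges C"
  obtains i where "i < n" "i \<notin> F" "X = cls (Spine i)" "Y = cls (Spine (Suc i))"
  | i where "i < n" "i \<notin> F" "Y = cls (Spine i)" "X = cls (Spine (Suc i))"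
  | x where "x \<in> leaf_verts" "X = {x}" "Y = cls (Spine (pos x))"
  | x where "x \<in> leaf_verts" "Y = {x}" "X = cls (Spine (pos x))"
  using assms that by (auto simp: edges_C doubleton_eq_iff)

lemma spine_edge_C: "i < n \<Longrightarrow> i \<notin> F \<Longrightarrow> {cls (Spine i), cls (Spine (Suc i))} \<in> edges C"
  by (auto simp: edges_C)

lemma leaf_edge_C: "x \<in> leaf_verts \<Longrightarrow> {{x}, cls (Spine (pos x))} \<in> edges C"
  by (auto simp: edges_C)

lemma leaf_edge_C_unique:
  assumes "x \<in> leaf_verts" "{{x}, Y} \<in> edges C"
  shows "Y = cls (Spine (pos x))"
  using assms(2)
proof (cases rule: edges_C_cases)
  case (1 i)
  then show ?thesis using cls_Spine_neq_leaf[OF assms(1), of i] by simp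
next
  case (2 i)
  then show ?thesis using cls_Spine_neq_leaf[OF assms(1), of "Suc i"] by simp
next
  case (4 y)
  then show ?thesis using cls_Spine_neq_leaf[OF assms(1), of "pos y"] by simp
qed auto

lemma lab_C: "lab C {x} = cat_label w x"
  by (simp add: contract_def lab_T)

lemma leaves_C: "leaves C = (\<lambda>x. {x}) ` leaf_verts"
proof -
  have leaf: "degree C {x} = 1" if x: "x \<in> leaf_verts" for x
  proof -
    have "{e \<in> edges C. {x} \<in> e} = {{{x}, cls (Spine (pos x))}}"
      using x cls_Spine_neq_leaf[OF x] by (auto simp: edges_C)
    then show ?thesis by (simp add: degree_def)
  qed
  have spine: "degree C (cls (Spine i)) \<noteq> 1" if i: "i \<le> n" for i
  proof
    assume "degree C (cls (Spine i)) = 1"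
    then have same: "e = e'" if "e \<in> edges C" "cls (Spine i) \<in> e" "e' \<in> edges C" "cls (Spine i) \<in> e'" for e e'
    proof -
      have "card {e \<in> edges C. cls (Spine i) \<in> e} = 1"
        using \<open>degree C (cls (Spine i)) = 1\<close> by (simp add: degree_def)
      then obtain f where f: "{e \<in> edges C. cls (Spine i) \<in> e} = {f}" by (rule card_1_singletonE)
      have "e \<in> {f}" "e' \<in> {f}" unfolding f[symmetric] using that by simp_all
      then show ?thesis by simp
    qed
    show False
    proof (cases "{..<i} \<subseteq> F")
      case True
      then have "cls (Spine 0) = cls (Spine i)" by (intro cls_interval) auto
      then have "{{Leaf_a}, cls (Spine i)} = {{Leaf_b}, cls (Spine i)}"
        using leaf_edge_C[OF Leaf_mem(2)] leaf_edge_C[OF Leaf_mem(3)] by (intro same) auto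
      then show False using cls_Spine_neq_leaf[OF Leaf_mem(2), of i] by (auto simp: doubleton_eq_iff)
    next
      case False
      define k where "k = Max ({..<i} - F)"
      have k: "k \<in> {..<i} - F" unfolding k_def using False by (intro Max_in) auto
      have "{Suc k..<i} \<subseteq> F"
      proof
        fix l assume l: "l \<in> {Suc k..<i}"
        show "l \<in> F"
        proof (rule ccontr)
          assume "l \<notin> F"
          then have "l \<le> k" unfolding k_def using l by (intro Max_ge) auto
          then show False using l by simp
        qed
      qed
      then have eq: "cls (Spine (Suc k)) = cls (Spine i)" using k by (intro cls_interval) auto
      have leaf: "Leaf i \<in> leaf_verts" using Leaf_mem(1)[of "i - 1"] k i by auto
      have "pos (Leaf i) = i" using i by simp
      then have "{cls (Spine k), cls (Spine i)} = {{Leaf i}, cls (Spine i)}"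
        using leaf_edge_C[OF leaf] spine_edge_C[of k] k i eq by (intro same) auto
      then show False using cls_Spine_neq_leaf[OF leaf] by (auto simp: doubleton_eq_iff)
    qed
  qed
  show ?thesis using leaf spine by (auto simp: leaves_def verts_C)
qed

text \<open>
  The part of the contracted tree on the far side, seen from the root, of edge \<open>i\<close>. It is used for
  edges outside \<open>F\<close>, where no contracted vertex lies on both sides.
\<close>

definition right_of :: "nat \<Rightarrow> cat_vertex set set" where
  "right_of i = cls ` {u \<in> verts T. i < pos u}"

lemma right_of_leaf: 
  assumes "x \<in> leaf_verts" shows "{x} \<in> right_of i \<longleftrightarrow> i < pos x"
proof
  assume "{x} \<in> right_of i"
  then obtain u where "u \<in> verts T" "i < pos u" "cls u = {x}" by (auto simp: right_of_def)
  then show "i < pos x" using refl_cls[of u] by auto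
next
  assume "i < pos x"
  then show "{x} \<in> right_of i" 
    using assms cls_leaf[OF assms] by (auto simp: right_of_def verts_T intro!: image_eqI[of _ _ x])
qed

lemma right_of_Spine:
  assumes "i \<notin> F" "k \<le> n" shows "cls (Spine k) \<in> right_of i \<longleftrightarrow> i < k"
proof
  assume "cls (Spine k) \<in> right_of i"
  then obtain u where u: "i < pos u" "cls u = cls (Spine k)" by (auto simp: right_of_def)
  then obtain j where "u = Spine j" using cls_Spine_subset[of u k] refl_cls[of u] by auto
  then have "i < j" "{k..<j} \<subseteq> F" using u cls_Spine_eqD[of j k] by auto
  then show "i < k" using assms by (meson atLeastLessThan_iff not_le subsetD)
next
  assume "i < k"
  then show "cls (Spine k) \<in> right_of i"
    using assms by (auto simp: right_of_def verts_T intro!: image_eqI[of _ _ "Spine k"])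
qed

lemma right_of_closed:
  assumes i: "i \<notin> F" and X: "X \<in> right_of i" and "{X, Y} \<in> edges C" "Y \<noteq> cls (Spine i)"
  shows "Y \<in> right_of i"
  using assms(3)
proof (cases rule: edges_C_cases)
  case (1 k)
  then show ?thesis using X i right_of_Spine[OF i] by simp
next
  case (2 k)
  then have "i < Suc k" using X right_of_Spine[OF i, of "Suc k"] by simp
  moreover have "i \<noteq> k" using assms(4) 2 by auto
  ultimately show ?thesis using 2 right_of_Spine[OF i, of k] by simp
next
  case (3 x)
  then show ?thesis using X right_of_leaf right_of_Spine[OF i] pos_le by simp
next
  case (4 x)
  then show ?thesis using X right_of_leaf right_of_Spine[OF i] pos_le by simp
qed

text \<open>
  A slide step with letter \<open>l\<close> labels the nearest unlabeled edge to the left of the leaf labeled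
  \<open>l\<close>. This does not depend on the comparison of branch minima.
\<close>

lemma slide_step_left:
  assumes M: "dom M = spine_edge ` F" and step: "slide_step T l M M'"
  obtains i j where "i < n" "i \<notin> F" "j \<le> n" "leaf_label j = int l" "i \<le> j"
    "\<And>k. i < k \<Longrightarrow> k \<le> j \<Longrightarrow> k < n \<Longrightarrow> k \<in> F" "M' = M(spine_edge i \<mapsto> l)"
proof -
  obtain x vl v p e where path: "is_path C (x # vl # v # p)"
    and x: "x \<in> leaves C" "lab C x = int l"
    and last: "last (v # p) \<in> leaves C" "lab C (last (v # p)) = label_a"
    and v: "v \<notin> leaves C"
    and e: "e \<in> edges T - spine_edge ` F" "cls ` e = {vl, v}" and M': "M' = M(e \<mapsto> l)"
    using step unfolding slide_step_def Let_def M by blast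
  obtain y where y: "y \<in> leaf_verts" "x = {y}" "cat_label w y = int l"
    using x by (auto simp: leaves_C lab_C)
  then obtain j where j: "j \<le> n" "y = Leaf (Suc j)" "leaf_label j = int l"
    using leaf_labelled_nat by blast
  obtain z where z: "z \<in> leaf_verts" "last (v # p) = {z}" using last(1) by (auto simp: leaves_C)
  then have lasta: "last (v # p) = {Leaf_a}"
    using last(2) leaf_labelled_a[of z] by (simp add: lab_C)
  have path': "{x, vl} \<in> edges C" "set (path_edges (v # p)) \<subseteq> edges C" "vl \<notin> set (v # p)"
    using path by (auto simp: is_path_def)
  have vl: "vl = cls (Spine (pos y))" using leaf_edge_C_unique[OF y(1)] path'(1) y(2) by simp
  have "e \<notin> (\<lambda>x. {x, Spine (pos x)}) ` leaf_verts"
  proof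
    assume "e \<in> (\<lambda>x. {x, Spine (pos x)}) ` leaf_verts"
    then obtain z where z: "z \<in> leaf_verts" "e = {z, Spine (pos z)}" by auto
    then have "{z} \<in> {vl, v}" using e(2) cls_leaf[OF z(1)] by auto
    then show False using v z(1) cls_Spine_neq_leaf[OF z(1)] by (auto simp: leaves_C vl)
  qed
  then obtain i where i: "i < n" "i \<notin> F" "e = spine_edge i"
    using e(1) by (auto simp: edges_T)
  have "{cls (Spine i), cls (Spine (Suc i))} = {vl, v}" using e(2) i(3) by (simp add: spine_edge_def)
  then consider "vl = cls (Spine i)" "v = cls (Spine (Suc i))" | "vl = cls (Spine (Suc i))"
    by (auto simp: doubleton_eq_iff)
  then show ?thesis
  proof cases
    \<comment> \<open>a path that leaves \<open>vl\<close> to the right can never reach \<open>a\<close>\<close>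
    case 1
    have "last (v # p) \<in> right_of i" if "v \<in> right_of i"
      using that path'(2,3)
    proof (induction p arbitrary: v)
      case (Cons u p)
      then have "u \<in> right_of i" using right_of_closed[OF i(2), of v u] 1(1) by auto
      then show ?case using Cons by simp
    qed simp
    moreover have "v \<in> right_of i" using 1 i right_of_Spine[of i "Suc i"] by simp
    ultimately show ?thesis using lasta right_of_leaf[OF Leaf_mem(2)] by simp
  next
    case 2
    have sub: "{Suc i..<pos y} \<subseteq> F" "{pos y..<Suc i} \<subseteq> F" 
      using cls_Spine_eqD[of "Suc i" "pos y"] vl 2 by auto
    then have "i < pos y" using i(2) by (meson atLeastLessThan_iff lessI not_le subsetD)
    then have "i \<le> j" using j by simp
    moreover have "k \<in> F" if "i < k" "k \<le> j" "k < n" for k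
      using sub(1) that j by auto
    ultimately show ?thesis using that[of i j] i j M' by blast
  qed
qed

text \<open>
  The spine to the left of edge \<open>i\<close> lies in the branch of \<open>a\<close> at the contracted
  vertex at the right end of that edge.
\<close>

lemma left_connected:
  assumes i: "i < n" "i \<notin> F" and "k \<le> i"
  shows "(cls (Spine k), {Leaf_a}) \<in> {(s, t). {s, t} \<in> edges C \<and> 
    s \<noteq> cls (Spine (Suc i)) \<and> t \<noteq> cls (Spine (Suc i))}\<^sup>*" (is "_ \<in> ?r\<^sup>*")
  using assms(3)
proof (induction k)
  have neq: "cls (Spine k) \<noteq> cls (Spine (Suc i))" if "k \<le> i" for k
    using cls_separated[OF that] i by simp
  {
    case 0
    have "(cls (Spine 0), {Leaf_a}) \<in> ?r"
      using leaf_edge_C[OF Leaf_mem(2)] neq[of 0] cls_Spine_neq_leaf[OF Leaf_mem(2), of "Suc i"]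
      by (auto simp: insert_commute)
    then show ?case by blast
  next
    case (Suc k)
    show ?case
    proof (cases "k \<in> F")
      case True
      then show ?thesis using Suc cls_step[of k] by simp
    next
      case False
      then have "(cls (Spine (Suc k)), cls (Spine k)) \<in> ?r"
        using spine_edge_C[of k] Suc(2) i neq[of k] neq[of "Suc k"] by (auto simp: insert_commute)
      then show ?thesis using Suc by (meson Suc_leD converse_rtrancl_into_rtrancl)
    qed
  }
qed

lemma isolated_leaf:
  assumes "x \<in> leaf_verts" 
    and "({x}, Y) \<in> {(s, t). {s, t} \<in> edges C \<and> s \<noteq> cls (Spine (pos x)) \<and> t \<noteq> cls (Spine (pos x))}\<^sup>*"
  shows "Y = {x}"
  using assms(2)
proof (cases rule: converse_rtranclE)
  case (step Z)
  then show ?thesis using leaf_edge_C_unique[OF assms(1), of Z] by simp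
qed simp

text \<open>
  The labels over which \<open>min_branch_label\<close> takes the minimum.
\<close>

definition slide_labels :: "cat_vertex set \<Rightarrow> nat \<Rightarrow> int set" where
  "slide_labels V l = \<Union>{branch_labels C B | B. B \<in> branches C V \<and>
     label_a \<notin> branch_labels C B \<and> int l \<notin> branch_labels C B}"

lemma min_branch_label_eq: "min_branch_label C V (int l) = Min (slide_labels V l)"
  by (simp add: min_branch_label_def slide_labels_def)

lemma finite_slide_labels: "finite (slide_labels V l)"
proof (rule finite_subset)
  show "slide_labels V l \<subseteq> lab C ` leaves C" by (auto simp: slide_labels_def branch_labels_def)
qed (simp add: leaves_C)

lemma branch_labelsE:
  assumes "m \<in> branch_labels C B"
  obtains x where "x \<in> leaf_verts" "{x} \<in> B" "m = cat_label w x"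
  using assms by (auto simp: branch_labels_def leaves_C lab_C)

lemma branch_labelsI: "x \<in> leaf_verts \<Longrightarrow> {x} \<in> B \<Longrightarrow> cat_label w x \<in> branch_labels C B"
  using imageI[of "{x}" "B \<inter> leaves C" "lab C"] 
  by (simp add: branch_labels_def leaves_C lab_C)

lemma leaf_branch_label:
  assumes x: "x \<in> leaf_verts" and V: "V = cls (Spine (pos x))"
    and "cat_label w x \<noteq> label_a" "cat_label w x \<noteq> int l"
  shows "cat_label w x \<in> slide_labels V l"
proof -
  define B where "B = {Y. ({x}, Y) \<in> {(s, t). {s, t} \<in> edges C \<and> s \<noteq> V \<and> t \<noteq> V}\<^sup>*}"
  have "B \<in> branches C V" unfolding branches_def B_def using leaf_edge_C[OF x] V by blast
  moreover have "B = {{x}}" using isolated_leaf[OF x] by (auto simp: B_def V)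
  then have "branch_labels C B = {cat_label w x}"
    using x by (auto simp: branch_labels_def leaves_C lab_C)
  moreover have "cat_label w x \<in> {cat_label w x}" "label_a \<notin> {cat_label w x}" "int l \<notin> {cat_label w x}"
    using assms(3,4) by auto
  ultimately show ?thesis unfolding slide_labels_def by (intro UnionI[of "branch_labels C B"] CollectI exI[of _ B]) simp_all
qed

lemma slide_labels_right:
  assumes i: "i < n" "i \<notin> F" and m: "m \<in> slide_labels (cls (Spine (Suc i))) l"
  obtains s where "i \<le> s" "s \<le> n" "leaf_label s \<noteq> int l" "m = leaf_label s"
proof -
  let ?V = "cls (Spine (Suc i))"
  let ?r = "{(s, t). {s, t} \<in> edges C \<and> s \<noteq> ?V \<and> t \<noteq> ?V}"
  obtain B where B: "B \<in> branches C ?V" "label_a \<notin> branch_labels C B" 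
    "int l \<notin> branch_labels C B" "m \<in> branch_labels C B"
    using m by (auto simp: slide_labels_def)
  obtain x where x: "x \<in> leaf_verts" "{x} \<in> B" "m = cat_label w x" 
    using branch_labelsE[OF B(4)] .
  obtain u where u: "B = {y. (u, y) \<in> ?r\<^sup>*}" using B(1) by (auto simp: branches_def)
  have "i < pos x"
  proof (rule ccontr)
    assume "\<not> i < pos x"
    then have le: "pos x \<le> i" by simp
    have "cls (Spine (pos x)) \<noteq> ?V" using cls_separated[OF le] i by simp
    then have "({x}, cls (Spine (pos x))) \<in> ?r"
      using leaf_edge_C[OF x(1)] cls_Spine_neq_leaf[OF x(1), of "Suc i"] by auto
    moreover have "(u, {x}) \<in> ?r\<^sup>*" using x(2) u by simp
    ultimately have "(u, {Leaf_a}) \<in> ?r\<^sup>*" 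
      using left_connected[OF i le] by (meson rtrancl.rtrancl_into_rtrancl rtrancl_trans)
    then have "{Leaf_a} \<in> B" using u by simp
    then show False using B(2) branch_labelsI[OF Leaf_mem(2)] by simp
  qed
  then obtain s where s: "s \<le> n" "x = Leaf (Suc s)" using x(1) by (auto simp: leaf_verts_def)
  have "leaf_label s \<noteq> int l" using x(3) s B(3,4) by auto
  then show ?thesis using that[of s] s x(3) \<open>i < pos x\<close> by simp
qed

lemma slide_labels_nonempty:
  assumes "j \<le> n" "leaf_label j = int l"
  shows "slide_labels (cls (Spine (min (Suc j) n))) l \<noteq> {}"
proof -
  have same: ?thesis if s: "s \<le> n" "s \<noteq> j" "cls (Spine (min (Suc s) n)) = cls (Spine (min (Suc j) n))" for s
  proof -
    have "cat_label w (Leaf (Suc s)) \<in> slide_labels (cls (Spine (min (Suc j) n))) l"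
      using s assms leaf_label_nonneg[of s] leaf_label_inj[of s j] Leaf_mem(1)[of s]
      by (intro leaf_branch_label) auto
    then show ?thesis by auto
  qed
  \<comment> \<open>a second leaf at the contracted vertex, or else the branch on its right, supplies a label\<close>
  consider "j = n" | "j = n - 1" | "Suc j < n" "Suc j \<in> F" | "Suc j < n" "Suc j \<notin> F" 
    using assms(1) by linarith
  then show ?thesis
  proof cases
    case 1
    then show ?thesis using same[of "n - 1"] n_pos by (simp del: length_greater_0_conv)
  next
    case 2
    then show ?thesis using same[of n] n_pos by (simp del: length_greater_0_conv)
  next
    case 3
    then show ?thesis using same[of "Suc j"] cls_step[of "Suc j"] by (simp add: min_def)
  next
    case 4
    let ?V = "cls (Spine (Suc j))" and ?U = "cls (Spine (Suc (Suc j)))"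
    let ?r = "{(s, t). {s, t} \<in> edges C \<and> s \<noteq> ?V \<and> t \<noteq> ?V}"
    define B where "B = {Y. (?U, Y) \<in> ?r\<^sup>*}"
    have "B \<in> branches C ?V" unfolding branches_def B_def 
      using spine_edge_C[of "Suc j"] 4 by (auto simp: insert_commute)
    moreover have right: "B \<subseteq> right_of (Suc j)"
    proof
      fix Y assume "Y \<in> B"
      then have "(?U, Y) \<in> ?r\<^sup>*" by (simp add: B_def)
      then show "Y \<in> right_of (Suc j)"
      proof (induction rule: rtrancl_induct)
        case base
        then show ?case using right_of_Spine[OF 4(2), of "Suc (Suc j)"] 4 by simp
      next
        case (step Y Z)
        then show ?case using right_of_closed[OF 4(2), of Y Z] by simp
      qed
    qed
    have "label_a \<notin> branch_labels C B"
    proof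
      assume "label_a \<in> branch_labels C B"
      then obtain x where x: "x \<in> leaf_verts" "{x} \<in> B" "label_a = cat_label w x" 
        by (rule branch_labelsE)
      then have "x = Leaf_a" using leaf_labelled_a[of x] by simp
      then show False using x right right_of_leaf[OF x(1)] by auto
    qed
    moreover have "int l \<notin> branch_labels C B"
    proof
      assume "int l \<in> branch_labels C B"
      then obtain x where x: "x \<in> leaf_verts" "{x} \<in> B" "int l = cat_label w x" 
        by (rule branch_labelsE)
      then have "x = Leaf (Suc j)" using label_inj[OF x(1) Leaf_mem(1)[OF assms(1)]] assms by simp
      then show False using x right right_of_leaf[OF x(1)] by auto
    qed
    moreover have "cat_label w (Leaf (Suc (Suc j))) \<in> branch_labels C B"
    proof (rule branch_labelsI)
      show leaf: "Leaf (Suc (Suc j)) \<in> leaf_verts" using Leaf_mem(1)[of "Suc j"] 4 by simp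
      have "?U \<noteq> ?V" using cls_separated[of "Suc j" "Suc j"] 4 by force
      moreover have "pos (Leaf (Suc (Suc j))) = Suc (Suc j)" using 4 by simp
      ultimately have "(?U, {Leaf (Suc (Suc j))}) \<in> ?r"
        using leaf_edge_C[OF leaf] cls_Spine_neq_leaf[OF leaf, of "Suc j"] by (auto simp: insert_commute)
      then show "{Leaf (Suc (Suc j))} \<in> B" unfolding B_def by blast
    qed
    ultimately have "cat_label w (Leaf (Suc (Suc j))) \<in> slide_labels ?V l"
      unfolding slide_labels_def by blast
    then show ?thesis using 4 by (auto simp: min_def)
  qed
qed

text \<open>
  A sufficient condition for a slide step. In the second case, the comparison of minima is witnessed by
  leaf \<open>h\<close>, which hangs off the near end of edge \<open>i\<close> once the edges between \<open>h\<close> and \<open>i\<close> are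
  contracted; in the first case it is witnessed by the leaf labeled \<open>b\<close>.
\<close>

lemma slide_stepI:
  assumes M: "dom M = spine_edge ` F" 
    and i: "i < n" "i \<notin> F" and j: "j \<le> n" "leaf_label j = int l" "i \<le> j"
    and between: "\<And>k. i < k \<Longrightarrow> k \<le> j \<Longrightarrow> k < n \<Longrightarrow> k \<in> F"
    and cond: "{..<i} \<subseteq> F \<or> (\<exists>h<i. {h<..<i} \<subseteq> F \<and> 
      (\<forall>s\<le>n. i \<le> s \<longrightarrow> leaf_label s \<noteq> int l \<longrightarrow> leaf_label h \<le> leaf_label s))"
  shows "slide_step T l M (M(spine_edge i \<mapsto> l))"
proof -
  let ?x = "Leaf (Suc j)" and ?V = "cls (Spine (Suc i))" and ?v = "cls (Spine i)"
  let ?r = "{(s, t). {s, t} \<in> edges C \<and> s \<noteq> ?V \<and> t \<noteq> ?V}"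
  have leaf: "?x \<in> leaf_verts" using Leaf_mem(1) j by simp
  have V: "cls (Spine (pos ?x)) = ?V"
    using between i j by (intro cls_interval[symmetric]) auto
  have neq: "?v \<noteq> ?V" using cls_separated[of i i] i by simp
  obtain q where q: "q \<noteq> []" "hd q = ?v" "last q = {Leaf_a}" "distinct q"
     "set (path_edges q) \<subseteq> edges C" "\<forall>y\<in>set q. (?v, y) \<in> ?r\<^sup>*"
    using rtrancl_imp_path[OF left_connected[OF i order_refl]] by blast
  obtain p where p: "q = ?v # p" using q(1,2) by (cases q) auto
  have "?V \<notin> set q"
  proof
    assume "?V \<in> set q"
    then have "(?v, ?V) \<in> ?r\<^sup>*" using q(6) by blast
    then show False by (cases rule: rtranclE) (use neq in auto)
  qed
  moreover have "{?x} \<notin> set q"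
  proof
    assume "{?x} \<in> set q"
    then have "(?v, {?x}) \<in> ?r\<^sup>*" using q(6) by blast
    then show False
    proof (cases rule: rtranclE)
      case (step Z)
      then show ?thesis using leaf_edge_C_unique[OF leaf, of Z] V by (auto simp: insert_commute)
    qed (use cls_Spine_neq_leaf[OF leaf] in auto)
  qed
  moreover have "set q \<subseteq> verts C"
  proof
    have stay: "Z \<in> verts C" if "{Y, Z} \<in> edges C" for Y Z
      using that by (cases rule: edges_C_cases) (auto simp: verts_C pos_le)
    fix y assume "y \<in> set q"
    then have "(?v, y) \<in> ?r\<^sup>*" using q(6) by blast
    then show "y \<in> verts C" by (cases rule: rtranclE) (use i stay in \<open>auto simp: verts_C\<close>)
  qed
  moreover have "{{?x}, ?V} \<in> edges C" "{?V, ?v} \<in> edges C"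
    using leaf_edge_C[OF leaf] spine_edge_C[OF i] V by (auto simp: insert_commute)
  moreover have "{?x} \<noteq> ?V" using cls_Spine_neq_leaf[OF leaf, of "Suc i"] by auto
  ultimately have path: "is_path C ({?x} # ?V # ?v # p)"
    using q p leaf i by (auto simp: is_path_def verts_C)
  have "min_branch_label C ?v (int l) \<le> min_branch_label C ?V (int l)"
  proof -
    have "slide_labels ?V l \<noteq> {}" using slide_labels_nonempty[OF j(1,2)] V by simp
    then have "Min (slide_labels ?V l) \<in> slide_labels ?V l" 
      by (intro Min_in finite_slide_labels)
    then obtain s where s: "i \<le> s" "s \<le> n" "leaf_label s \<noteq> int l" 
      "Min (slide_labels ?V l) = leaf_label s"
      by (rule slide_labels_right[OF i])
    from cond have "\<exists>m\<in>slide_labels ?v l. m \<le> leaf_label s"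
    proof
      assume "{..<i} \<subseteq> F"
      then have "cls (Spine 0) = ?v" by (intro cls_interval) auto
      then have "cat_label w Leaf_b \<in> slide_labels ?v l"
        by (intro leaf_branch_label Leaf_mem) auto
      then show ?thesis using leaf_label_nonneg[OF s(2)] by (intro bexI) auto
    next
      assume "\<exists>h<i. {h<..<i} \<subseteq> F \<and> 
        (\<forall>s\<le>n. i \<le> s \<longrightarrow> leaf_label s \<noteq> int l \<longrightarrow> leaf_label h \<le> leaf_label s)"
      then obtain h where h: "h < i" "{h<..<i} \<subseteq> F" "leaf_label h \<le> leaf_label s" using s by blast
      have "{Suc h..<i} = {h<..<i}" by auto
      then have "?v = cls (Spine (pos (Leaf (Suc h))))" 
        using h i cls_interval[of "Suc h" i] by simp
      moreover have "leaf_label h \<noteq> int l" using leaf_label_inj[of h j] h i j by auto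
      ultimately have "cat_label w (Leaf (Suc h)) \<in> slide_labels ?v l"
        using h i leaf_label_nonneg[of h] by (intro leaf_branch_label Leaf_mem) auto
      then show ?thesis using h by auto
    qed
    then show ?thesis unfolding min_branch_label_eq s(4)
      using Min_le[OF finite_slide_labels] by (meson order_trans)
  qed
  moreover have "{Leaf_a} \<in> leaves C" "lab C {Leaf_a} = label_a" "{?x} \<in> leaves C" 
    "lab C {?x} = int l" "?v \<notin> leaves C"
    using leaf Leaf_mem j cls_Spine_neq_leaf by (auto simp: leaves_C lab_C)
  moreover have "spine_edge i \<in> edges T - spine_edge ` F" 
    using i by (auto simp: edges_T inj_spine_edge)
  moreover have "cls ` spine_edge i = {?V, ?v}" by (auto simp: spine_edge_def)
  ultimately show ?thesis using path q(3) unfolding slide_step_def Let_def M p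
    by (intro exI[of _ "{?x}"] exI[of _ "?V"] exI[of _ "?v"] exI[of _ p] exI[of _ "spine_edge i"]) simp
qed

end

section \<open>Slide labelings of the tree of a word\<close>

context labelled_word_tree
begin

text \<open>
  The analogue of \<open>well_placed\<close> for a single labeled edge of a partial labeling.
\<close>

definition placed_after :: "(cat_vertex set \<rightharpoonup> nat) \<Rightarrow> nat \<Rightarrow> nat \<Rightarrow> bool" where
  "placed_after M i l \<longleftrightarrow> (\<exists>j\<le>n. leaf_label j = int l \<and> i \<le> j \<and>
     (\<forall>k. i < k \<and> k \<le> j \<and> k < n \<longrightarrow> (\<exists>l'. M (spine_edge k) = Some l' \<and> l \<le> l')))"

lemma slide_steps_placed_after:
  assumes "sorted_wrt (\<ge>) ls" "slide_steps T ls M M'"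
    and "F \<subseteq> {..<n}" "dom M = spine_edge ` F"
    and "\<And>i l. M (spine_edge i) = Some l \<Longrightarrow> placed_after M i l"
    and "\<And>i l l'. M (spine_edge i) = Some l \<Longrightarrow> l' \<in> set ls \<Longrightarrow> l' \<le> l"
    and "M' (spine_edge i) = Some l"
  shows "placed_after M' i l"
  using assms
proof (induction ls arbitrary: M F)
  case (Cons a ls)
  obtain M1 where step: "slide_step T a M M1" and steps: "slide_steps T ls M1 M'"
    using Cons.prems(2) by auto
  interpret contracted_word_tree w F using Cons.prems(3) by unfold_locales
  obtain h j where h: "h < n" "h \<notin> F" and j: "j \<le> n" "leaf_label j = int a" "h \<le> j"
    and between: "\<And>k. h < k \<Longrightarrow> k \<le> j \<Longrightarrow> k < n \<Longrightarrow> k \<in> F" and M1: "M1 = M(spine_edge h \<mapsto> a)"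
    using slide_step_left[OF Cons.prems(4) step] by metis
  have "spine_edge h \<notin> dom M" using h Cons.prems(4) by (auto simp: inj_spine_edge)
  then have new: "M (spine_edge h) = None" by (simp add: domIff)
  have M1_old: "M1 (spine_edge k) = Some b" if "M (spine_edge k) = Some b" for k b
    using that new by (auto simp: M1 inj_spine_edge)
  have M1_cases: "k = h \<and> b = a \<or> M (spine_edge k) = Some b" if "M1 (spine_edge k) = Some b" for k b
    using that by (auto simp: M1 inj_spine_edge split: if_splits)
  have "\<exists>b. M1 (spine_edge k) = Some b \<and> a \<le> b" if k: "h < k" "k \<le> j" "k < n" for k
  proof -
    have "spine_edge k \<in> dom M" using between[OF k] Cons.prems(4) by simp
    then obtain b where "M (spine_edge k) = Some b" by auto
    then show ?thesis using M1_old Cons.prems(6) by force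
  qed
  then have "placed_after M1 h a" unfolding placed_after_def using j by blast
  moreover have "placed_after M1 k b" if "M (spine_edge k) = Some b" for k b
    using Cons.prems(5)[OF that] M1_old unfolding placed_after_def by meson
  ultimately have placed: "placed_after M1 k b" if "M1 (spine_edge k) = Some b" for k b
    using M1_cases[OF that] by auto
  have large: "l' \<le> b" if "M1 (spine_edge k) = Some b" "l' \<in> set ls" for k b l'
    using M1_cases[OF that(1)] that(2) Cons.prems(1,6) by auto
  have dom: "dom M1 = spine_edge ` insert h F" using Cons.prems(4) by (simp add: M1)
  show ?case
    by (rule Cons.IH[of M1 "insert h F"]) 
      (use Cons.prems(1,3,7) h steps dom placed large in auto)
qed simp

lemma well_placed_if_edge_word:
  assumes "sorted_wrt (\<ge>) ls" "slide_steps T ls Map.empty M" "has_edge_word T M w"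
  shows "well_placed w"
  unfolding well_placed_def
proof (intro allI impI)
  have M: "M (spine_edge i) = Some (w ! i)" if "i < n" for i
    using assms(3) that by (simp add: has_edge_word_iff)
  fix i assume i: "i < n"
  have "placed_after M i (w ! i)"
    by (rule slide_steps_placed_after[OF assms(1,2), of "{}"]) (use M i in auto)
  then obtain j where j: "j \<le> n" "leaf_label j = int (w ! i)" "i \<le> j"
    and between: "\<forall>k. i < k \<and> k \<le> j \<and> k < n \<longrightarrow> (\<exists>l'. M (spine_edge k) = Some l' \<and> w ! i \<le> l')"
    unfolding placed_after_def by blast
  have "w ! i \<le> w ! k" if k: "k < n" "i \<le> k" "k \<le> j" for k
  proof (cases "k = i")
    case False
    then obtain l' where "M (spine_edge k) = Some l'" "w ! i \<le> l'"
      using between k by (metis le_neq_implies_less)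
    then show ?thesis using M[OF k(1)] by simp
  qed simp
  then show "\<exists>j\<le>n. leaf_label j = int (w ! i) \<and> i \<le> j \<and> (\<forall>k<n. i \<le> k \<and> k \<le> j \<longrightarrow> w ! i \<le> w ! k)"
    using j by blast
qed

text \<open>
  The remaining letters \<open>ls\<close> are those of the edges outside \<open>F\<close>, and \<open>F\<close> is closed under passing
  to larger letters and to later occurrences of the same letter. Each step labels the last one
  among the edges outside \<open>F\<close> that carry the largest remaining letter.
\<close>

lemma slide_steps_exist:
  assumes wp: "well_placed w"
    and cond: "\<And>h i s. h < i \<Longrightarrow> i < n \<Longrightarrow> w ! h \<le> w ! i \<Longrightarrow> 
      (\<And>k. h < k \<Longrightarrow> k < i \<Longrightarrow> w ! i < w ! k) \<Longrightarrow> i \<le> s \<Longrightarrow> s \<le> n \<Longrightarrow> 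
      leaf_label s \<noteq> int (w ! i) \<Longrightarrow> leaf_label h \<le> leaf_label s"
    and "sorted_wrt (\<ge>) ls"
    and "F \<subseteq> {..<n}" "dom M = spine_edge ` F" "\<And>i. i \<in> F \<Longrightarrow> M (spine_edge i) = Some (w ! i)"
    and "\<And>x. count_list ls x = card {k. k < n \<and> k \<notin> F \<and> w ! k = x}"
    and "\<And>i k. i \<in> F \<Longrightarrow> k < n \<Longrightarrow> w ! i < w ! k \<or> w ! i = w ! k \<and> i < k \<Longrightarrow> k \<in> F"
  shows "\<exists>M'. slide_steps T ls M M' \<and> (\<forall>i<n. M' (spine_edge i) = Some (w ! i))"
  using assms(3-)
proof (induction ls arbitrary: M F)
  case Nil
  have "k \<in> F" if "k < n" for k
  proof (rule ccontr)
    assume "k \<notin> F"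
    then have "k \<in> {k'. k' < n \<and> k' \<notin> F \<and> w ! k' = w ! k}" using that by simp
    moreover have "card {k'. k' < n \<and> k' \<notin> F \<and> w ! k' = w ! k} = 0" 
      using Nil.prems(5)[of "w ! k"] by simp
    ultimately show False by (auto simp: card_eq_0_iff)
  qed
  then show ?case using Nil.prems(4) by auto
next
  case (Cons l ls)
  interpret contracted_word_tree w F using Cons.prems(2) by unfold_locales
  define A where "A = {k. k < n \<and> k \<notin> F \<and> w ! k = l}"
  define i where "i = Max A"
  have fin: "finite A" by (simp add: A_def)
  have "card A > 0" using Cons.prems(5)[of l] by (simp add: A_def)
  then have "A \<noteq> {}" by auto
  then have "i \<in> A" using fin unfolding i_def by (rule Max_in[rotated])
  then have i: "i < n" "i \<notin> F" "w ! i = l" by (auto simp: A_def)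
  have last: "k \<le> i" if "k < n" "k \<notin> F" "w ! k = l" for k
    using that fin unfolding i_def by (intro Max_ge) (auto simp: A_def)
  have le: "w ! k \<le> l" if "k < n" "k \<notin> F" for k
  proof -
    have "k \<in> {k'. k' < n \<and> k' \<notin> F \<and> w ! k' = w ! k}" using that by simp
    then have "card {k'. k' < n \<and> k' \<notin> F \<and> w ! k' = w ! k} \<noteq> 0" by (auto simp: card_eq_0_iff)
    then have "count_list (l # ls) (w ! k) \<noteq> 0" using Cons.prems(5)[of "w ! k"] by simp
    then have "w ! k \<in> set (l # ls)" by (metis count_notin)
    then show ?thesis using Cons.prems(1) by auto
  qed
  obtain j where j: "j \<le> n" "leaf_label j = int l" "i \<le> j" 
    and above: "\<forall>k<n. i \<le> k \<and> k \<le> j \<longrightarrow> l \<le> w ! k"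
    using wp i unfolding well_placed_def by blast
  have between: "k \<in> F" if "i < k" "k \<le> j" "k < n" for k
    using le[of k] last[of k] above that by force
  have step: "slide_step T l M (M(spine_edge i \<mapsto> l))"
  proof (rule slide_stepI[OF Cons.prems(3) i(1,2) j between])
    show "{..<i} \<subseteq> F \<or> (\<exists>h<i. {h<..<i} \<subseteq> F \<and>
      (\<forall>s\<le>n. i \<le> s \<longrightarrow> leaf_label s \<noteq> int l \<longrightarrow> leaf_label h \<le> leaf_label s))"
    proof (cases "{..<i} \<subseteq> F")
      case False
      define h where "h = Max ({..<i} - F)"
      have h: "h < i" "h \<notin> F" using Max_in[of "{..<i} - F"] False unfolding h_def by blast+
      have inF: "k \<in> F" if "h < k" "k < i" for k
      proof (rule ccontr)
        assume "k \<notin> F"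
        then have "k \<le> h" unfolding h_def using that by (intro Max_ge) auto
        then show False using that by simp
      qed
      moreover have "w ! i < w ! k" if "h < k" "k < i" for k
        using Cons.prems(6)[OF inF[OF that] i(1)] i(2) that by (metis linorder_neqE_nat)
      ultimately show ?thesis using cond[of h i] h i le[of h] by (intro disjI2 exI[of _ h]) auto
    qed simp
  qed
  have "\<exists>M'. slide_steps T ls (M(spine_edge i \<mapsto> l)) M' \<and> (\<forall>i<n. M' (spine_edge i) = Some (w ! i))"
  proof (rule Cons.IH[of "insert i F"])
    show "sorted_wrt (\<ge>) ls" using Cons.prems(1) by simp
    show "insert i F \<subseteq> {..<n}" using Cons.prems(2) i by simp
    show "dom (M(spine_edge i \<mapsto> l)) = spine_edge ` insert i F" using Cons.prems(3) by simp
    show "(M(spine_edge i \<mapsto> l)) (spine_edge k) = Some (w ! k)" if "k \<in> insert i F" for k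
      using that Cons.prems(4) i by (auto simp: inj_spine_edge)
    show "k \<in> insert i F" if "h \<in> insert i F" "k < n" "w ! h < w ! k \<or> w ! h = w ! k \<and> h < k" for h k
      using that Cons.prems(6)[of h k] le[of k] last[of k] i by fastforce
    show "count_list ls x = card {k. k < n \<and> k \<notin> insert i F \<and> w ! k = x}" for x
    proof (cases "x = l")
      case True
      then have "{k. k < n \<and> k \<notin> insert i F \<and> w ! k = x} = A - {i}" by (auto simp: A_def)
      then show ?thesis using Cons.prems(5)[of l] True \<open>i \<in> A\<close> fin by (simp add: A_def[symmetric])
    next
      case False
      then have "{k. k < n \<and> k \<notin> insert i F \<and> w ! k = x} = {k. k < n \<and> k \<notin> F \<and> w ! k = x}" 
        using i by auto
      then show ?thesis using Cons.prems(5)[of x] False by simp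
    qed
  qed
  then show ?case using step by auto
qed

end

section \<open>Words of right-justified content\<close>

lemma sorted_wrt_ge_replicate: "sorted_wrt (\<ge>) (replicate k (x :: nat))"
  by (induction k) auto

lemma sorted_slide_sequence: 
  "sorted_wrt (\<ge>) (concat (map (\<lambda>l. replicate (f l) l) (rev [1..<Suc m])))"
proof (induction m)
  case (Suc m)
  then show ?case by (auto simp: sorted_wrt_append sorted_wrt_ge_replicate)
qed simp

lemma count_list_replicate: "count_list (replicate k y) x = (if x = y then k else 0)"
  by (induction k) auto

lemma count_list_slide_sequence:
  "count_list (concat (map (\<lambda>l. replicate (f l) l) (rev [1..<Suc m]))) x =
     (if x \<in> {1..m} then f x else 0)"
proof (induction m)
  case (Suc m)
  then show ?case by (auto simp: count_list_replicate)
qed simp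

lemma length_eq_of_content:
  assumes "composition n ks" "has_content ks w"
  shows "length w = n"
proof -
  have n: "length ks = n" "sum_list ks = n" using assms(1) by (auto simp: composition_def)
  have "length w = (\<Sum>x\<in>{1..n}. count_list w x)"
    using assms(2) n by (intro sum_count_set[symmetric]) (auto simp: has_content_def)
  also have "\<dots> = (\<Sum>x\<in>{1..n}. ks ! (x - 1))"
    using assms(2) n by (intro sum.cong) (auto simp: has_content_def)
  also have "\<dots> = (\<Sum>k<n. ks ! k)" by (simp add: sum.atLeast1_atMost_eq)
  also have "\<dots> = sum_list ks" using n by (simp add: sum_list_sum_nth atLeast0LessThan)
  finally show ?thesis using n by simp
qed

lemma full_word_of_content:
  assumes "n \<ge> 1" "composition n ks" "right_justified ks" "has_content ks w"
  shows "full_word w"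
proof
  have len: "length w = n" "length ks = n" 
    using length_eq_of_content assms by (auto simp: composition_def)
  show "w \<noteq> []" using len assms(1) by auto
  show "set w \<subseteq> {1..length w}" using assms(4) len by (simp add: has_content_def)
  fix x y assume xy: "x \<in> set w" "x \<le> y" "y \<le> length w"
  have x: "1 \<le> x" using assms(4) xy(1) by (auto simp: has_content_def)
  have count: "count_list w z = ks ! (z - 1)" if "1 \<le> z" "z \<le> n" for z
    using assms(4) that len by (auto simp: has_content_def)
  have "count_list w x = ks ! (x - 1)" "count_list w y = ks ! (y - 1)"
    using x xy len by (intro count; linarith)+
  moreover have "count_list w x \<noteq> 0" using xy(1) by (simp add: count_list_0_iff)
  ultimately have "ks ! (x - 1) \<noteq> 0" by simp
  moreover have "y - 1 < n" "x - 1 < n" "\<not> y - 1 < x - 1" using x xy len by auto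
  moreover have "i < j" if "i < n" "j < n" "ks ! i = 0" "ks ! j \<noteq> 0" for i j
    using assms(3) len(2) that by (simp add: right_justified_def)
  ultimately have "ks ! (y - 1) \<noteq> 0" by metis
  then have "count_list w y \<noteq> 0" using \<open>count_list w y = ks ! (y - 1)\<close> by simp
  then show "y \<in> set w" by (simp add: count_list_0_iff)
qed

theorem theorem1p3:
  fixes n :: nat and ks w :: "nat list"
  assumes "n \<ge> 1"
    and "composition n ks"
    and "right_justified ks"
    and "has_content ks w"
  shows "(tree_of_word w \<in> Slide_psi ks \<and>
          (\<exists>M. slide_labeling ks (tree_of_word w) M \<and> has_edge_word (tree_of_word w) M w))
         \<longleftrightarrow> (avoids_2_1_2 w \<and> avoids_23_bar2_1 w)"
    (is "?slide \<longleftrightarrow> ?avoid")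
proof -
  interpret full_word w using full_word_of_content[OF assms] .
  have len: "length w = n" "length ks = n" 
    using length_eq_of_content assms by (auto simp: composition_def)
  define ls where "ls = concat (map (\<lambda>l. replicate (ks ! (l - 1)) l) (rev [1..<Suc n]))"
  have labeling: "slide_labeling ks (tree_of_word w) M \<longleftrightarrow> slide_steps (tree_of_word w) ls Map.empty M" for M
    by (simp add: slide_labeling_def ls_def len)
  have sorted: "sorted_wrt (\<ge>) ls" unfolding ls_def by (rule sorted_slide_sequence)
  show ?thesis
  proof
    assume ?slide
    then obtain M where "stable_tree n (tree_of_word w)" 
      and M: "slide_steps (tree_of_word w) ls Map.empty M" "has_edge_word (tree_of_word w) M w"
      by (auto simp: Slide_psi_def labeling len)
    then interpret labelled_word_tree w
      by unfold_locales (simp add: stable_tree_def leaves_T lab_T len)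
    have "well_placed w" using well_placed_if_edge_word[OF sorted M] .
    moreover have "inj_on ((!) (word_labels w)) {..length w}"
      using leaf_label_inj by (auto simp: inj_on_def)
    ultimately show ?avoid 
      using well_placed_avoids_212 well_placed_avoids_23_bar2_1 by blast
  next
    assume ?avoid
    then interpret avoiding_word w by unfold_locales auto
    interpret labelled_word_tree w
      by unfold_locales (rule bij_betw_cat_label[OF bij_betw_leaf_label])
    \<comment> \<open>initially no edge is labeled, and the remaining letters are those of \<open>w\<close>\<close>
    have count: "count_list ls x = card {k. k < length w \<and> k \<notin> {} \<and> w ! k = x}" for x
    proof -
      have "card {k. k < length w \<and> k \<notin> {} \<and> w ! k = x} = count_list w x"
        by (simp add: count_list_eq_length_filter length_filter_conv_card eq_commute)
      moreover have "count_list w x = (if x \<in> {1..n} then ks ! (x - 1) else 0)"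
        using assms(4) len by (auto simp: has_content_def count_list_0_iff)
      ultimately show ?thesis unfolding ls_def count_list_slide_sequence by simp
    qed
    have "\<exists>M. slide_steps (tree_of_word w) ls Map.empty M \<and> 
        (\<forall>i<length w. M (spine_edge i) = Some (w ! i))"
      by (rule slide_steps_exist[OF well_placed slide_condition sorted _ _ _ count]) auto
    then obtain M where M: "slide_steps (tree_of_word w) ls Map.empty M" 
        "\<forall>i<length w. M (spine_edge i) = Some (w ! i)" by blast
    then have "has_edge_word (tree_of_word w) M w" by (simp add: has_edge_word_iff)
    then show ?slide using M(1) stable_tree_T by (auto simp: Slide_psi_def labeling len)
  qed
qed

end
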